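(* Let $k$ be a number field with ring of integers $R$ and let $A=\left(\frac{a,b}{k}\right)$ be a quaternion algebra over $k$, where $a,b\in R$ satisfy: (i) $(a,b)=1$; and either (ii) there exist $\tilde a,\tilde b\in R$ such that $\tilde a^2\equiv a \bmod 4R$ and $\tilde b^2\equiv b\bmod 4R$, or (ii)$'$ $b=-1$ and there exists $\tilde a\in R$ such that $\tilde a^2\equiv a\bmod 4R$. Suppose in addition that $\Delta(A)=abR$. Let $\mathcal{O}'=R[1,i,j,ij]$. Then there exists $\beta\in\frac12\mathcal{O}'$ such that $\mathcal{O}=R[1,i,\beta,i\beta]$ is a maximal order of $A$ and $\mathcal{O}'\subset\mathcal{O}$.
   Context: $A=\left(\frac{a,b}{k}\right)$ denotes the quaternion algebra over $k$ with basis $1,i,j,ij$ and relations $i^2=a$, $j^2=b$, $ij=-ji$ ($a,b\in k^*$). $\Delta(A)$ is the discriminant of $A$, i.e. the product of the prime ideals of $R$ at which $A$ is ramified. For $e_1,\dots,e_4\in A$, $R[e_1,e_2,e_3,e_4]$ denotes the $R$-submodule of $A$ spanned by $e_1,\dots,e_4$. An order of $A$ is a complete $R$-lattice in $A$ (finitely generated $R$-submodule spanning $A$ over $k$) that is also a ring with $1$; it is maximal if it is maximal with respect to inclusion. $(a,b)=1$ means that $a$ and $b$ are coprime, i.e. generate the unit ideal of $R$. *)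

theory Defs
  imports "HOL-Algebra.Algebra" "HOL-Algebra.Algebraic_Closure_Type"
begin

section \<open>Number fields and their rings of integers\<close>

definition number_field :: "'k::field_char_0 itself \<Rightarrow> bool" where
  "number_field _ \<longleftrightarrow>
     (\<exists>B :: 'k set. finite B \<and> module.span (\<lambda>(q::rat) x. of_rat q * x) B = UNIV)"

abbreviation field_ring :: "'k::field_char_0 ring" where
  "field_ring \<equiv> ring_of_type_algebra"

definition ring_of_integers :: "'k::field_char_0 ring" where
  "ring_of_integers = field_ring\<lparr>carrier := {x. algebraic_int x}\<rparr>"

definition submodule_span ::
  "('r, 'm) ring_scheme \<Rightarrow> ('r, 'v, 'n) module_scheme \<Rightarrow> 'v set \<Rightarrow> 'v set" where
  "submodule_span R M E = (\<lambda>N. submodule N R M) hull E"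


section \<open>Quaternion algebras\<close>

type_synonym 'f quaternion = "'f \<times> 'f \<times> 'f \<times> 'f"

text \<open>The tuple \<open>(x0, x1, x2, x3)\<close> stands for \<open>x0 + x1 i + x2 j + x3 ij\<close>. The base field \<open>F\<close> is a
  record rather than a type, because it will also be a completion, which depends on a prime ideal.\<close>

definition quaternion_algebra ::
  "('f, 'm) ring_scheme \<Rightarrow> 'f \<Rightarrow> 'f \<Rightarrow> ('f, 'f quaternion) module" where
  "quaternion_algebra F a b =
    \<lparr>carrier = carrier F \<times> carrier F \<times> carrier F \<times> carrier F,
     monoid.mult = (\<lambda>(x0, x1, x2, x3) (y0, y1, y2, y3).
       (x0 \<otimes>\<^bsub>F\<^esub> y0 \<oplus>\<^bsub>F\<^esub> a \<otimes>\<^bsub>F\<^esub> x1 \<otimes>\<^bsub>F\<^esub> y1 \<oplus>\<^bsub>F\<^esub> b \<otimes>\<^bsub>F\<^esub> x2 \<otimes>\<^bsub>F\<^esub> y2 \<ominus>\<^bsub>F\<^esub> a \<otimes>\<^bsub>F\<^esub> b \<otimes>\<^bsub>F\<^esub> x3 \<otimes>\<^bsub>F\<^esub> y3,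
        x0 \<otimes>\<^bsub>F\<^esub> y1 \<oplus>\<^bsub>F\<^esub> x1 \<otimes>\<^bsub>F\<^esub> y0 \<oplus>\<^bsub>F\<^esub> b \<otimes>\<^bsub>F\<^esub> x3 \<otimes>\<^bsub>F\<^esub> y2 \<ominus>\<^bsub>F\<^esub> b \<otimes>\<^bsub>F\<^esub> x2 \<otimes>\<^bsub>F\<^esub> y3,
        x0 \<otimes>\<^bsub>F\<^esub> y2 \<oplus>\<^bsub>F\<^esub> x2 \<otimes>\<^bsub>F\<^esub> y0 \<oplus>\<^bsub>F\<^esub> a \<otimes>\<^bsub>F\<^esub> x1 \<otimes>\<^bsub>F\<^esub> y3 \<ominus>\<^bsub>F\<^esub> a \<otimes>\<^bsub>F\<^esub> x3 \<otimes>\<^bsub>F\<^esub> y1,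
        x0 \<otimes>\<^bsub>F\<^esub> y3 \<oplus>\<^bsub>F\<^esub> x3 \<otimes>\<^bsub>F\<^esub> y0 \<oplus>\<^bsub>F\<^esub> x1 \<otimes>\<^bsub>F\<^esub> y2 \<ominus>\<^bsub>F\<^esub> x2 \<otimes>\<^bsub>F\<^esub> y1)),
     one = (\<one>\<^bsub>F\<^esub>, \<zero>\<^bsub>F\<^esub>, \<zero>\<^bsub>F\<^esub>, \<zero>\<^bsub>F\<^esub>),
     ring.zero = (\<zero>\<^bsub>F\<^esub>, \<zero>\<^bsub>F\<^esub>, \<zero>\<^bsub>F\<^esub>, \<zero>\<^bsub>F\<^esub>),
     add = (\<lambda>(x0, x1, x2, x3) (y0, y1, y2, y3).
       (x0 \<oplus>\<^bsub>F\<^esub> y0, x1 \<oplus>\<^bsub>F\<^esub> y1, x2 \<oplus>\<^bsub>F\<^esub> y2, x3 \<oplus>\<^bsub>F\<^esub> y3)),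
     module.smult = (\<lambda>c (x0, x1, x2, x3). (c \<otimes>\<^bsub>F\<^esub> x0, c \<otimes>\<^bsub>F\<^esub> x1, c \<otimes>\<^bsub>F\<^esub> x2, c \<otimes>\<^bsub>F\<^esub> x3))\<rparr>"

abbreviation quat_alg :: "'k::field_char_0 \<Rightarrow> 'k \<Rightarrow> ('k, 'k quaternion) module" where
  "quat_alg \<equiv> quaternion_algebra field_ring"

definition qi :: "'k::field_char_0 quaternion" where "qi = (0, 1, 0, 0)"
definition qj :: "'k::field_char_0 quaternion" where "qj = (0, 0, 1, 0)"

lemma field_ring_simps [simp]:
  fixes x y :: "'k::field_char_0"
  shows "carrier (field_ring :: 'k ring) = UNIV"
    and "x \<otimes>\<^bsub>field_ring\<^esub> y = x * y"
    and "x \<oplus>\<^bsub>field_ring\<^esub> y = x + y"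
    and "\<one>\<^bsub>field_ring\<^esub> = (1 :: 'k)"
    and "\<zero>\<^bsub>field_ring\<^esub> = (0 :: 'k)"
    and "x \<ominus>\<^bsub>field_ring\<^esub> y = x - y"
proof -
  interpret F: field "field_ring :: 'k ring" by (rule field_from_type_algebra)
  have "\<ominus>\<^bsub>field_ring\<^esub> y = - y"
    by (intro F.minus_equality) (simp_all add: ring_of_type_algebra_def)
  then show "x \<ominus>\<^bsub>field_ring\<^esub> y = x - y" by (simp add: a_minus_def ring_of_type_algebra_def)
qed (simp_all add: ring_of_type_algebra_def)

lemma quat_alg_relations:
  fixes a b :: "'k::field_char_0"
  shows "qi \<otimes>\<^bsub>quat_alg a b\<^esub> qi = a \<odot>\<^bsub>quat_alg a b\<^esub> \<one>\<^bsub>quat_alg a b\<^esub>"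
    and "qj \<otimes>\<^bsub>quat_alg a b\<^esub> qj = b \<odot>\<^bsub>quat_alg a b\<^esub> \<one>\<^bsub>quat_alg a b\<^esub>"
    and "qi \<otimes>\<^bsub>quat_alg a b\<^esub> qj = (0, 0, 0, 1)"
    and "qj \<otimes>\<^bsub>quat_alg a b\<^esub> qi = (- 1) \<odot>\<^bsub>quat_alg a b\<^esub> (qi \<otimes>\<^bsub>quat_alg a b\<^esub> qj)"
  by (simp_all add: quaternion_algebra_def qi_def qj_def)


section \<open>Completion at a prime ideal\<close>

text \<open>\<open>padic_ball P n\<close> is \<open>P\<^sup>n\<close> extended to the localization of the ring of integers at the prime \<open>P\<close>,
  that is, the set of \<open>x\<close> whose \<open>P\<close>-adic valuation is at least \<open>n\<close>.\<close>

definition padic_ball :: "'k::field_char_0 set \<Rightarrow> nat \<Rightarrow> 'k set" where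
  "padic_ball P n =
     {x. \<exists>s \<in> carrier ring_of_integers - P. s * x \<in> P [^]\<^bsub>ideals_set ring_of_integers\<^esub> n}"

definition padic_cauchy :: "'k::field_char_0 set \<Rightarrow> (nat \<Rightarrow> 'k) set" where
  "padic_cauchy P = {u. \<forall>n. \<exists>N. \<forall>l\<ge>N. \<forall>m\<ge>N. u l - u m \<in> padic_ball P n}"

definition padic_null :: "'k::field_char_0 set \<Rightarrow> (nat \<Rightarrow> 'k) set" where
  "padic_null P = {u. \<forall>n. \<exists>N. \<forall>m\<ge>N. u m \<in> padic_ball P n}"

definition padic_cauchy_ring :: "'k::field_char_0 set \<Rightarrow> (nat \<Rightarrow> 'k) ring" where
  "padic_cauchy_ring P =
    \<lparr>carrier = padic_cauchy P,
     monoid.mult = (\<lambda>u v n. u n * v n),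
     one = (\<lambda>_. 1),
     ring.zero = (\<lambda>_. 0),
     add = (\<lambda>u v n. u n + v n)\<rparr>"

definition completion :: "'k::field_char_0 set \<Rightarrow> (nat \<Rightarrow> 'k) set ring" where
  "completion P = padic_cauchy_ring P Quot padic_null P"

definition to_completion :: "'k::field_char_0 set \<Rightarrow> 'k \<Rightarrow> (nat \<Rightarrow> 'k) set" where
  "to_completion P x = padic_null P +>\<^bsub>padic_cauchy_ring P\<^esub> (\<lambda>_. x)"


section \<open>Ramification, discriminant and orders\<close>

text \<open>All following notions refer to the algebra \<open>quat_alg a b\<close>. Its base change to the completion
  at \<open>P\<close> is the quaternion algebra over the completion with the same parameters, and \<open>P\<close> is ramified
  if that base change is a division algebra.\<close>

definition ramified_at :: "'k::field_char_0 \<Rightarrow> 'k \<Rightarrow> 'k set \<Rightarrow> bool" where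
  "ramified_at a b P \<longleftrightarrow>
     (let A = quaternion_algebra (completion P) (to_completion P a) (to_completion P b)
      in Units A = carrier A - {\<zero>\<^bsub>A\<^esub>})"

definition ramified_primes :: "'k::field_char_0 \<Rightarrow> 'k \<Rightarrow> 'k set set" where
  "ramified_primes a b =
     {P. primeideal P ring_of_integers \<and> P \<noteq> {0} \<and> ramified_at a b P}"

text \<open>Over a number field only finitely many primes ramify. HOL needs a value in the other case too;
  we use the zero ideal, because \<open>finprod\<close> would return the unit ideal, the discriminant of an
  algebra that is unramified at every prime.\<close>

definition discriminant :: "'k::field_char_0 \<Rightarrow> 'k \<Rightarrow> 'k set" where
  "discriminant a b =
     (if finite (ramified_primes a b)
      then finprod (ideals_set ring_of_integers) (\<lambda>P. P) (ramified_primes a b)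
      else {0})"

definition complete_lattice_in :: "'k::field_char_0 \<Rightarrow> 'k \<Rightarrow> 'k quaternion set \<Rightarrow> bool" where
  "complete_lattice_in a b L \<longleftrightarrow>
     (\<exists>E. finite E \<and> L = submodule_span ring_of_integers (quat_alg a b) E) \<and>
     submodule_span field_ring (quat_alg a b) L = carrier (quat_alg a b)"

definition order_in :: "'k::field_char_0 \<Rightarrow> 'k \<Rightarrow> 'k quaternion set \<Rightarrow> bool" where
  "order_in a b L \<longleftrightarrow> complete_lattice_in a b L \<and> subring L (quat_alg a b)"

definition maximal_order_in :: "'k::field_char_0 \<Rightarrow> 'k \<Rightarrow> 'k quaternion set \<Rightarrow> bool" where
  "maximal_order_in a b L \<longleftrightarrow>
     order_in a b L \<and> (\<forall>L'. order_in a b L' \<and> L \<subseteq> L' \<longrightarrow> L' = L)"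

definition standard_order :: "'k::field_char_0 \<Rightarrow> 'k \<Rightarrow> 'k quaternion set" where
  "standard_order a b = submodule_span ring_of_integers (quat_alg a b)
     {\<one>\<^bsub>quat_alg a b\<^esub>, qi, qj, qi \<otimes>\<^bsub>quat_alg a b\<^esub> qj}"

end

theory Submission
  imports Defs "Jordan_Normal_Form.Char_Poly"
begin

text \<open>
  Put \<open>\<beta> = (p + q i + j) / 2\<close>, where \<open>p\<close> and \<open>q\<close> in \<open>R\<close> are chosen with \<open>p\<^sup>2 - a q\<^sup>2 - b = 4 c\<close> and \<open>c\<close> in
  \<open>R\<close>. Then \<open>\<beta>\<close> has reduced trace \<open>p\<close> and reduced norm \<open>c\<close>, the product \<open>i \<beta>\<close> has integral trace \<open>a q\<close>,
  and therefore \<open>\<O> = R[1, i, \<beta>, i \<beta>]\<close> is an order; it contains \<open>j = 2 \<beta> - p - q i\<close>. If \<open>b\<close> is a square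
  \<open>b'\<^sup>2\<close> modulo 4, take \<open>p = b'\<close> and \<open>q = 0\<close>. If \<open>b = -1\<close> and \<open>a\<close> is a square \<open>a'\<^sup>2\<close> modulo 4, take
  \<open>p = 0\<close> and for \<open>q\<close> an inverse of \<open>a'\<close> modulo 2. The inverse exists since 2 is a unit at each prime
  dividing \<open>a b\<close>: the discriminant \<open>a b R\<close> is a product of distinct primes, while a prime that divides
  both 2 and a square modulo 4 divides the latter twice.

  The reduced discriminant of \<open>\<O>\<close> is \<open>a b\<close>, the discriminant of the algebra, and this forces
  maximality, as follows. Let \<open>x\<close> lie in an order that contains \<open>\<O>\<close>. Reduced traces and norms of elements of orders are integral
  (\<open>order_trd_nrd_integral\<close>). Pairing \<open>x\<close> with \<open>\<O>\<close> under the trace gives \<open>a b x \<in> \<O>\<close>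
  (\<open>integral_multiple_in_enlarged_order\<close>), so only primes \<open>P\<close> dividing \<open>a b\<close> matter, that is, the ramified
  ones. Let \<open>a\<close> be in \<open>P\<close>, hence \<open>b\<close> not. If \<open>b\<close> were a square modulo \<open>P\<close>, Hensel's lemma would give a
  square root of \<open>b\<close> in the completion, and the completed algebra would contain zero divisors. So the form
  \<open>u\<^sup>2 - b v\<^sup>2\<close> is anisotropic modulo \<open>P\<close> (\<open>ramified_anisotropic\<close>), and integrality of the reduced norm
  removes the last possible denominators of the coordinates of \<open>x\<close> at \<open>P\<close> (\<open>coordinates_in_Loc\<close>). Hence
  the ideal of all \<open>r\<close> with \<open>r x \<in> \<O>\<close> contains \<open>a b\<close> and lies in no ramified prime, and so it is \<open>R\<close>.

  On the arithmetic of \<open>R\<close>: integrality rests on the determinant trick. That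
  nonzero primes are maximal and that valuations are finite both follow from \<open>prime_absorbs_power\<close>.
  Uniformizers come from the hypothesis on the discriminant: \<open>a b\<close> generates a product of distinct primes,
  so it is a uniformizer at each of them (\<open>prime_factor_uniformizer\<close>).
\<close>

section \<open>Integrality and finitely generated modules\<close>

interpretation zmod: Modules.module "\<lambda>(n::int) (x::'k::field_char_0). of_int n * x"
  by unfold_locales (simp_all add: algebra_simps)

lemma zspan_mult_left:
  assumes "\<And>v. v \<in> V \<Longrightarrow> t * v \<in> zmod.span W" "x \<in> zmod.span V"
  shows "t * x \<in> zmod.span W"
  using assms(2)
proof (induction rule: zmod.span_induct_alt)
  case base
  then show ?case by (simp add: zmod.span_zero)
next
  case (step c x y)
  have "t * (of_int c * x + y) = of_int c * (t * x) + t * y" by (simp add: algebra_simps)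
  then show ?case using step assms(1) by (simp add: zmod.span_add zmod.span_scale)
qed

text \<open>The determinant trick: multiplication by \<open>t\<close> on the generators in \<open>V\<close> is given by an integer matrix,
  and \<open>t\<close> is an eigenvalue of that matrix, the vector of generators being an eigenvector. So \<open>t\<close> is a
  root of its characteristic polynomial.\<close>

lemma algebraic_int_if_zspan_stable:
  fixes t :: "'k::field_char_0"
  assumes fin: "finite V" and nz: "v0 \<in> V" "v0 \<noteq> 0"
    and stable: "\<And>v. v \<in> V \<Longrightarrow> t * v \<in> zmod.span V"
  shows "algebraic_int t"
proof -
  have "\<exists>c. t * v = (\<Sum>w\<in>V. of_int (c w) * w)" if "v \<in> V" for v
    using stable[OF that] unfolding zmod.span_finite[OF fin] by auto
  then obtain c where c: "\<And>v. v \<in> V \<Longrightarrow> t * v = (\<Sum>w\<in>V. of_int (c v w) * w)"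
    by metis
  obtain vs where vs: "set vs = V" "distinct vs" using finite_distinct_list[OF fin] by auto
  define n where "n = length vs"
  define A :: "int mat" where "A = mat n n (\<lambda>(i, j). c (vs ! i) (vs ! j))"
  define A' where "A' = map_mat (of_int :: int \<Rightarrow> 'k) A"
  define v where "v = vec n (\<lambda>i. vs ! i)"
  have A: "A \<in> carrier_mat n n" and A': "A' \<in> carrier_mat n n" by (auto simp: A_def A'_def)
  have "A' *\<^sub>v v = t \<cdot>\<^sub>v v"
  proof (rule eq_vecI)
    fix i assume "i < dim_vec (t \<cdot>\<^sub>v v)"
    then have i: "i < n" by (simp add: v_def)
    have "(A' *\<^sub>v v) $ i = (\<Sum>j = 0..<n. of_int (c (vs ! i) (vs ! j)) * vs ! j)"
      using i by (auto simp: A'_def A_def v_def scalar_prod_def intro!: sum.cong)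
    also have "\<dots> = (\<Sum>w\<leftarrow>vs. of_int (c (vs ! i) w) * w)"
      by (simp add: n_def sum_list_sum_nth)
    also have "\<dots> = (\<Sum>w\<in>V. of_int (c (vs ! i) w) * w)"
      using vs sum_list_distinct_conv_sum_set by metis
    also have "\<dots> = t * vs ! i" using c[of "vs ! i"] i vs by (auto simp: n_def)
    finally show "(A' *\<^sub>v v) $ i = (t \<cdot>\<^sub>v v) $ i" using i by (simp add: v_def)
  qed (auto simp: A'_def A_def v_def)
  moreover have "v \<noteq> 0\<^sub>v n"
  proof
    assume "v = 0\<^sub>v n"
    obtain i where "i < n" "vs ! i = v0" using nz vs by (metis in_set_conv_nth n_def)
    with \<open>v = 0\<^sub>v n\<close> nz show False by (metis index_vec index_zero_vec(1) v_def)
  qed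
  ultimately have "eigenvector A' v t"
    using A' by (simp add: eigenvector_def v_def)
  then have "poly (char_poly A') t = 0"
    using eigenvalue_root_char_poly[OF A'] by (auto simp: eigenvalue_def)
  moreover have "char_poly A' = map_poly of_int (char_poly A)"
    unfolding A'_def by (rule of_int_hom.char_poly_hom[OF A])
  moreover have "lead_coeff (char_poly A) = 1" using degree_monic_char_poly[OF A] by simp
  ultimately show ?thesis unfolding algebraic_int_altdef_ipoly by metis
qed

lemma zspan_mult:
  assumes "x \<in> zmod.span V" "y \<in> zmod.span W"
  shows "x * y \<in> zmod.span ((\<lambda>(v, w). v * w) ` (V \<times> W))" (is "_ \<in> zmod.span ?U")
proof (rule zspan_mult_left[OF _ assms(2)])
  fix w assume "w \<in> W"
  have "w * x \<in> zmod.span ?U"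
    by (rule zspan_mult_left[OF _ assms(1)]) (use \<open>w \<in> W\<close> in \<open>force intro!: zmod.span_base simp: mult.commute\<close>)
  then show "x * w \<in> zmod.span ?U" by (simp add: mult.commute)
qed

text \<open>\<open>B\<close> generates, as an additive group, a subring of the field. Such sets stand in for the
  subrings generated by finitely many algebraic integers.\<close>

definition zsubring_basis :: "'k::field_char_0 set \<Rightarrow> bool" where
  "zsubring_basis B \<longleftrightarrow> finite B \<and> 1 \<in> zmod.span B \<and>
     (\<forall>x \<in> zmod.span B. \<forall>y \<in> zmod.span B. x * y \<in> zmod.span B)"

text \<open>The compositum of two finite subrings is spanned by the pairwise products of generators.\<close>

lemma zsubring_basis_product:
  assumes "zsubring_basis B" "zsubring_basis C"
  obtains D where "zsubring_basis D" "zmod.span B \<subseteq> zmod.span D" "zmod.span C \<subseteq> zmod.span D"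
proof
  let ?D = "(\<lambda>(v, w). v * w) ` (B \<times> C)"
  have prod: "x * y \<in> zmod.span ?D" if "x \<in> zmod.span B" "y \<in> zmod.span C" for x y
    using that by (rule zspan_mult)
  show B: "zmod.span B \<subseteq> zmod.span ?D" using prod[of _ 1] assms by (auto simp: zsubring_basis_def)
  show "zmod.span C \<subseteq> zmod.span ?D" using prod[of 1] assms by (auto simp: zsubring_basis_def)
  have gen: "(b * c) * y \<in> zmod.span ?D" if "b \<in> zmod.span B" "c \<in> zmod.span C" "y \<in> zmod.span ?D" for b c y
  proof (rule zspan_mult_left[OF _ that(3)])
    fix v assume "v \<in> ?D"
    then obtain b' c' where v: "v = b' * c'" "b' \<in> zmod.span B" "c' \<in> zmod.span C"
      by (auto intro: zmod.span_base)
    have "(b * b') * (c * c') \<in> zmod.span ?D"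
      using that v assms by (intro prod) (auto simp: zsubring_basis_def)
    then show "b * c * v \<in> zmod.span ?D" by (simp add: v mult_ac)
  qed
  have "y * x \<in> zmod.span ?D" if "x \<in> zmod.span ?D" "y \<in> zmod.span ?D" for x y
  proof (rule zspan_mult_left[OF _ that(1)])
    fix v assume "v \<in> ?D"
    then show "y * v \<in> zmod.span ?D"
      using gen[OF zmod.span_base zmod.span_base that(2)] by (auto simp: mult_ac)
  qed
  then show "zsubring_basis ?D"
    using assms B by (auto simp: zsubring_basis_def)
qed

text \<open>A monic equation of degree \<open>d\<close> for \<open>t\<close> expresses \<open>t\<^sup>d\<close> through lower powers, so that the powers below
  \<open>d\<close> span \<open>\<int>[t]\<close>.\<close>

lemma zsubring_basis_powers:
  fixes t :: "'k::field_char_0"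
  assumes "algebraic_int t"
  obtains B where "zsubring_basis B" "t \<in> zmod.span B"
proof -
  obtain p where p: "poly (map_poly of_int p) t = 0" "lead_coeff p = 1"
    using assms algebraic_int_altdef_ipoly by blast
  define d where "d = degree p"
  define B where "B = (\<lambda>i. t ^ i) ` {..<d}"
  have "d \<noteq> 0"
  proof
    assume "d = 0"
    then have "p = [:1:]" using p(2) d_def by (metis degree_eq_zeroE lead_coeff_pCons(2) pCons_0_0 lead_coeff_pCons(1))
    then show False using p(1) by simp
  qed
  \<comment> \<open>The monic equation, solved for its leading term.\<close>
  have "(\<Sum>i\<le>d. of_int (coeff p i) * t ^ i) = 0"
    using p(1) by (simp add: poly_altdef d_def coeff_map_poly degree_map_poly)
  then have "t ^ d = - (\<Sum>i<d. of_int (coeff p i) * t ^ i)"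
    using p(2) by (simp add: d_def lessThan_Suc_atMost [symmetric] add_eq_0_iff)
  also have "\<dots> \<in> zmod.span B"
    by (intro zmod.span_neg zmod.span_sum zmod.span_scale zmod.span_base) (auto simp: B_def)
  finally have td: "t ^ d \<in> zmod.span B" .
  have stable: "t * x \<in> zmod.span B" if "x \<in> zmod.span B" for x
  proof (rule zspan_mult_left[OF _ that])
    fix v assume "v \<in> B"
    then obtain i where i: "v = t ^ i" "i < d" by (auto simp: B_def)
    show "t * v \<in> zmod.span B"
    proof (cases "Suc i = d")
      case True
      then show ?thesis using td i by auto
    next
      case False
      then have "t ^ Suc i \<in> B" using i unfolding B_def by (intro imageI) auto
      then show ?thesis using i zmod.span_base by auto
    qed
  qed
  have one: "1 \<in> zmod.span B" using \<open>d \<noteq> 0\<close> by (intro zmod.span_base) (auto simp: B_def image_iff intro!: bexI[of _ 0])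
  have pow: "t ^ i * x \<in> zmod.span B" if "x \<in> zmod.span B" for i x
    by (induction i) (use that stable in \<open>auto simp: mult.assoc\<close>)
  have "y * x \<in> zmod.span B" if "x \<in> zmod.span B" "y \<in> zmod.span B" for x y
    by (rule zspan_mult_left[OF _ that(1)]) (use pow[OF that(2)] in \<open>auto simp: B_def mult.commute\<close>)
  then have "zsubring_basis B" using one by (auto simp: zsubring_basis_def B_def)
  moreover have "t \<in> zmod.span B" using stable[OF one] by simp
  ultimately show ?thesis using that by blast
qed

lemma zsubring_basis_exists:
  fixes S :: "'k::field_char_0 set"
  assumes "finite S" "\<And>s. s \<in> S \<Longrightarrow> algebraic_int s"
  shows "\<exists>B. zsubring_basis B \<and> S \<subseteq> zmod.span B"
  using assms
proof (induction S)
  case empty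
  show ?case using zsubring_basis_powers[of 1] by (metis algebraic_int_1 empty_subsetI)
next
  case (insert s S)
  then obtain B where B: "zsubring_basis B" "S \<subseteq> zmod.span B" by auto
  obtain C where C: "zsubring_basis C" "s \<in> zmod.span C"
    using zsubring_basis_powers insert.prems by blast
  obtain D where "zsubring_basis D" "zmod.span B \<subseteq> zmod.span D" "zmod.span C \<subseteq> zmod.span D"
    using zsubring_basis_product B C by blast
  then show ?case using B C by (intro exI[of _ D]) auto
qed

lemma algebraic_int_zsubring_basis:
  assumes "zsubring_basis B" "t \<in> zmod.span B"
  shows "algebraic_int t"
proof -
  have "\<exists>v0 \<in> B. v0 \<noteq> 0"
  proof (rule ccontr)
    assume "\<not> ?thesis"
    then have "zmod.span B \<subseteq> zmod.span {0}" by (intro zmod.span_mono) auto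
    then show False using assms(1) by (auto simp: zsubring_basis_def zmod.span_singleton)
  qed
  then show ?thesis
    using assms by (auto intro: algebraic_int_if_zspan_stable[of B] zmod.span_base simp: zsubring_basis_def)
qed

lemma algebraic_int_add [simp, intro]:
  fixes x y :: "'k::field_char_0"
  assumes "algebraic_int x" "algebraic_int y"
  shows "algebraic_int (x + y)"
proof -
  obtain B where B: "zsubring_basis B" "x \<in> zmod.span B" "y \<in> zmod.span B"
    using zsubring_basis_exists[of "{x, y}"] assms by auto
  show ?thesis by (rule algebraic_int_zsubring_basis[OF B(1) zmod.span_add[OF B(2,3)]])
qed

lemma algebraic_int_mult [simp, intro]:
  fixes x y :: "'k::field_char_0"
  assumes "algebraic_int x" "algebraic_int y"
  shows "algebraic_int (x * y)"
proof -
  obtain B where B: "zsubring_basis B" "x \<in> zmod.span B" "y \<in> zmod.span B"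
    using zsubring_basis_exists[of "{x, y}"] assms by auto
  show ?thesis
    using B by (intro algebraic_int_zsubring_basis[OF B(1)]) (auto simp: zsubring_basis_def)
qed

lemma algebraic_int_diff [simp, intro]:
  fixes x y :: "'k::field_char_0"
  assumes "algebraic_int x" "algebraic_int y"
  shows "algebraic_int (x - y)"
  using algebraic_int_add[of x "- y"] assms by (simp add: algebraic_int_minus)

lemma algebraic_int_power [simp, intro]:
  fixes x :: "'k::field_char_0"
  shows "algebraic_int x \<Longrightarrow> algebraic_int (x ^ n)"
  by (induction n) auto

text \<open>The \<open>R\<close>-submodule of the field generated by \<open>V\<close>, where \<open>R\<close> is the ring of integers.\<close>

inductive_set int_span :: "'k::field_char_0 set \<Rightarrow> 'k set" for V where
  zero: "0 \<in> int_span V"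
| base: "v \<in> V \<Longrightarrow> v \<in> int_span V"
| add: "x \<in> int_span V \<Longrightarrow> y \<in> int_span V \<Longrightarrow> x + y \<in> int_span V"
| scale: "algebraic_int r \<Longrightarrow> x \<in> int_span V \<Longrightarrow> r * x \<in> int_span V"

text \<open>An element of an \<open>R\<close>-span involves finitely many coefficients. Once these lie in a subring spanned
  by a finite set \<open>B\<close>, the element is a \<open>\<int>\<close>-combination of products of \<open>B\<close> with the generators. This
  reduces questions over \<open>R\<close> to questions over \<open>\<int>\<close>.\<close>

lemma int_span_finite_support:
  assumes "x \<in> int_span V"
  shows "\<exists>S. finite S \<and> (\<forall>s\<in>S. algebraic_int s) \<and>
    (\<forall>B. zsubring_basis B \<longrightarrow> S \<subseteq> zmod.span B \<longrightarrow> x \<in> zmod.span ((\<lambda>(b, v). b * v) ` (B \<times> V)))"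
  using assms
proof induction
  case zero
  show ?case by (rule exI[of _ "{}"]) (auto simp: zmod.span_zero)
next
  case (base v)
  have "1 * v \<in> zmod.span ((\<lambda>(b, v). b * v) ` (B \<times> V))" if "zsubring_basis B" for B
    by (rule zspan_mult) (use that base in \<open>auto simp: zsubring_basis_def intro: zmod.span_base\<close>)
  then show ?case by (intro exI[of _ "{}"]) auto
next
  case (add x y)
  then obtain S T where "finite S \<and> (\<forall>s\<in>S. algebraic_int s) \<and>
    (\<forall>B. zsubring_basis B \<longrightarrow> S \<subseteq> zmod.span B \<longrightarrow> x \<in> zmod.span ((\<lambda>(b, v). b * v) ` (B \<times> V)))"
    "finite T \<and> (\<forall>s\<in>T. algebraic_int s) \<and>
    (\<forall>B. zsubring_basis B \<longrightarrow> T \<subseteq> zmod.span B \<longrightarrow> y \<in> zmod.span ((\<lambda>(b, v). b * v) ` (B \<times> V)))"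
    by blast
  then show ?case by (intro exI[of _ "S \<union> T"]) (auto intro: zmod.span_add)
next
  case (scale r x)
  then obtain S where S: "finite S" "\<forall>s\<in>S. algebraic_int s"
    "\<And>B. zsubring_basis B \<Longrightarrow> S \<subseteq> zmod.span B \<Longrightarrow> x \<in> zmod.span ((\<lambda>(b, v). b * v) ` (B \<times> V))"
    by blast
  have "r * x \<in> zmod.span ((\<lambda>(b, v). b * v) ` (B \<times> V))" 
    if B: "zsubring_basis B" "insert r S \<subseteq> zmod.span B" for B
  proof (rule zspan_mult_left[of "(\<lambda>(b, v). b * v) ` (B \<times> V)"])
    show "x \<in> zmod.span ((\<lambda>(b, v). b * v) ` (B \<times> V))" using S B by auto
  next
    fix u assume "u \<in> (\<lambda>(b, v). b * v) ` (B \<times> V)"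
    then obtain b v where u: "u = b * v" "b \<in> B" "v \<in> V" by auto
    have "(r * b) * v \<in> zmod.span ((\<lambda>(b, v). b * v) ` (B \<times> V))"
      using B u by (intro zspan_mult) (auto simp: zsubring_basis_def intro: zmod.span_base)
    then show "r * u \<in> zmod.span ((\<lambda>(b, v). b * v) ` (B \<times> V))" by (simp add: u mult.assoc)
  qed
  then show ?case using S scale.hyps by (intro exI[of _ "insert r S"]) auto
qed

text \<open>The determinant trick over \<open>R\<close>; it contains the fact that \<open>R\<close> is integrally closed.\<close>

lemma algebraic_int_if_int_span_stable:
  assumes fin: "finite V" and nz: "v0 \<in> V" "v0 \<noteq> 0"
    and stable: "\<And>v. v \<in> V \<Longrightarrow> t * v \<in> int_span V"
  shows "algebraic_int t"
proof -
  obtain S where S: "\<And>v. v \<in> V \<Longrightarrow> finite (S v) \<and> (\<forall>s\<in>S v. algebraic_int s) \<and>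
    (\<forall>B. zsubring_basis B \<longrightarrow> S v \<subseteq> zmod.span B \<longrightarrow> t * v \<in> zmod.span ((\<lambda>(b, v). b * v) ` (B \<times> V)))"
    using int_span_finite_support[OF stable] by metis
  obtain B where B: "zsubring_basis B" "(\<Union>v\<in>V. S v) \<subseteq> zmod.span B"
    using zsubring_basis_exists[of "\<Union>v\<in>V. S v"] S fin by blast
  define U where "U = (\<lambda>(b, v). b * v) ` (B \<times> V)"
  have tU: "t * v \<in> zmod.span U" if "v \<in> V" for v using S[OF that] B that unfolding U_def by blast
  have BU: "b * x \<in> zmod.span U" if "b \<in> B" "x \<in> zmod.span U" for b x
  proof (rule zspan_mult_left[OF _ that(2)])
    fix u assume "u \<in> U"
    then obtain b' v where u: "u = b' * v" "b' \<in> B" "v \<in> V" by (auto simp: U_def)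
    have "b * b' \<in> zmod.span B"
      using B(1) zmod.span_base[OF that(1)] zmod.span_base[OF u(2)] by (auto simp: zsubring_basis_def)
    then have "(b * b') * v \<in> zmod.span U"
      unfolding U_def by (rule zspan_mult) (use u(3) zmod.span_base in blast)
    then show "b * u \<in> zmod.span U" by (simp add: u mult.assoc)
  qed
  have "\<exists>u0 \<in> U. u0 \<noteq> 0"
  proof (rule ccontr)
    assume "\<not> ?thesis"
    then have "zmod.span U \<subseteq> zmod.span {0}" by (intro zmod.span_mono) auto
    moreover have "1 * v0 \<in> zmod.span U"
      unfolding U_def using B nz by (intro zspan_mult) (auto simp: zsubring_basis_def intro: zmod.span_base)
    ultimately show False using nz by (auto simp: zmod.span_singleton)
  qed
  then obtain u0 where u0: "u0 \<in> U" "u0 \<noteq> 0" by blast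
  show ?thesis
  proof (rule algebraic_int_if_zspan_stable[OF _ u0])
    show "finite U" using B fin by (auto simp: U_def zsubring_basis_def)
    fix u assume "u \<in> U"
    then obtain b v where u: "u = b * v" "b \<in> B" "v \<in> V" by (auto simp: U_def)
    then show "t * u \<in> zmod.span U" using BU[OF u(2) tU[OF u(3)]] by (simp add: mult_ac)
  qed
qed

text \<open>Let \<open>n\<close> be a common denominator of the rational matrix by which \<open>x\<close> acts on a finite
  generating set over \<open>\<rat>\<close>; then \<open>n x\<close> preserves the \<open>\<int>\<close>-span of that set.\<close>

lemma number_field_denominator:
  fixes x :: "'k::field_char_0"
  assumes "number_field TYPE('k)"
  shows "\<exists>n::int. n \<noteq> 0 \<and> algebraic_int (of_int n * x)"
proof -
  interpret qmod: Modules.module "\<lambda>(q::rat) (x::'k). of_rat q * x"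
    by unfold_locales (simp_all add: algebra_simps of_rat_add of_rat_mult)
  obtain B :: "'k set" where B: "finite B" "qmod.span B = UNIV"
    using assms by (auto simp: number_field_def)
  have "\<exists>q. x * b = (\<Sum>b'\<in>B. of_rat (q b') * b')" for b
  proof -
    have "x * b \<in> qmod.span B" using B by simp
    then show ?thesis unfolding qmod.span_finite[OF B(1)] by auto
  qed
  then obtain q where q: "\<And>b. x * b = (\<Sum>b'\<in>B. of_rat (q b b') * b')" by metis
  define d where "d = (\<lambda>r. snd (quotient_of r))"
  \<comment> \<open>A common denominator of all matrix entries.\<close>
  define n where "n = (\<Prod>(b, b')\<in>B \<times> B. d (q b b'))"
  have dpos: "d r > 0" for r by (simp add: d_def quotient_of_denom_pos')
  have "n \<noteq> 0" unfolding n_def using dpos B(1) by (auto simp: prod_zero_iff) (metis less_irrefl)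
  have int: "\<exists>m::int. of_int n * of_rat (q b b') = (of_int m :: 'k)" if "b \<in> B" "b' \<in> B" for b b'
  proof -
    have "d (q b b') dvd n" unfolding n_def
      using dvd_prodI[of "B \<times> B" "(b, b')" "\<lambda>(b, b'). d (q b b')"] that B(1) by auto
    then obtain k where k: "n = d (q b b') * k" by auto
    have "of_int (d (q b b')) * q b b' = of_int (fst (quotient_of (q b b')))"
      using quotient_of_div[of "q b b'" "fst (quotient_of (q b b'))" "d (q b b')"] dpos[of "q b b'"]
      by (simp add: d_def field_simps)
    then have "of_int n * q b b' = of_int (k * fst (quotient_of (q b b')))"
      by (simp add: k mult_ac)
    then have "(of_rat (of_int n * q b b') :: 'k) = of_rat (of_int (k * fst (quotient_of (q b b'))))"
      by simp
    then show ?thesis by (metis of_rat_mult of_rat_of_int_eq)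
  qed
  have "\<exists>v0 \<in> B. v0 \<noteq> 0"
  proof (rule ccontr)
    assume "\<not> ?thesis"
    then have "qmod.span B \<subseteq> qmod.span {0}" by (intro qmod.span_mono) auto
    then have "UNIV \<subseteq> {0::'k}" using B(2) by (simp add: qmod.span_singleton)
    then have "(1::'k) \<in> {0}" by blast
    then show False by simp
  qed
  then obtain v0 where v0: "v0 \<in> B" "v0 \<noteq> 0" by blast
  have "algebraic_int (of_int n * x)"
  proof (rule algebraic_int_if_zspan_stable[OF B(1) v0])
    fix b assume b: "b \<in> B"
    have "of_int n * x * b = (\<Sum>b'\<in>B. (of_int n * of_rat (q b b')) * b')"
      by (simp add: mult.assoc q[of b] sum_distrib_left)
    also have "\<dots> \<in> zmod.span B"
    proof (rule zmod.span_sum)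
      fix b' assume "b' \<in> B"
      then obtain m :: int where m: "of_int n * of_rat (q b b') = (of_int m :: 'k)" using int b by blast
      show "of_int n * of_rat (q b b') * b' \<in> zmod.span B"
        unfolding m using \<open>b' \<in> B\<close> by (intro zmod.span_scale zmod.span_base)
    qed
    finally show "of_int n * x * b \<in> zmod.span B" .
  qed
  then show ?thesis using \<open>n \<noteq> 0\<close> by blast
qed

section \<open>Prime ideals of the ring of integers\<close>

lemma ring_of_integers_simps [simp]:
  fixes x y :: "'k::field_char_0"
  shows "x \<in> carrier ring_of_integers \<longleftrightarrow> algebraic_int x"
    and "x \<otimes>\<^bsub>ring_of_integers\<^esub> y = x * y"
    and "x \<oplus>\<^bsub>ring_of_integers\<^esub> y = x + y"
    and "\<one>\<^bsub>ring_of_integers\<^esub> = (1 :: 'k)"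
    and "\<zero>\<^bsub>ring_of_integers\<^esub> = (0 :: 'k)"
  by (simp_all add: ring_of_integers_def ring_of_type_algebra_def)

lemma cring_ring_of_integers: "cring (ring_of_integers :: 'k::field_char_0 ring)"
proof (rule cringI)
  show "abelian_group (ring_of_integers :: 'k ring)"
    by (rule abelian_groupI) (auto simp: algebra_simps intro!: exI[of _ "- _"] bexI[of _ "- _"])
  show "comm_monoid (ring_of_integers :: 'k ring)"
    by (rule comm_monoidI) (auto simp: algebra_simps)
qed (auto simp: algebra_simps)

interpretation OK: cring ring_of_integers
  by (rule cring_ring_of_integers)

lemma ideal_OK:
  assumes "ideal I ring_of_integers"
  shows "x \<in> I \<Longrightarrow> algebraic_int x" "0 \<in> I" "x \<in> I \<Longrightarrow> y \<in> I \<Longrightarrow> x + y \<in> I"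
    "algebraic_int r \<Longrightarrow> x \<in> I \<Longrightarrow> r * x \<in> I" "algebraic_int r \<Longrightarrow> x \<in> I \<Longrightarrow> x * r \<in> I"
    "x \<in> I \<Longrightarrow> y \<in> I \<Longrightarrow> x - y \<in> I"
proof -
  interpret ideal I ring_of_integers by fact
  show *: "x \<in> I \<Longrightarrow> algebraic_int x" for x using Icarr by simp
  show "0 \<in> I" using zero_closed by simp
  show add: "x \<in> I \<Longrightarrow> y \<in> I \<Longrightarrow> x + y \<in> I" for x y using a_closed[of x y] by simp
  show mul: "algebraic_int r \<Longrightarrow> x \<in> I \<Longrightarrow> r * x \<in> I" for r x using I_l_closed[of x r] by simp
  show "algebraic_int r \<Longrightarrow> x \<in> I \<Longrightarrow> x * r \<in> I" using I_r_closed[of x r] by simp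
  show "x \<in> I \<Longrightarrow> y \<in> I \<Longrightarrow> x - y \<in> I"
    using add[of x "-1 * y"] mul[of "-1" y] by simp
qed

lemma primeideal_OK:
  assumes "primeideal P ring_of_integers"
  shows "ideal P ring_of_integers" "1 \<notin> P"
    "algebraic_int x \<Longrightarrow> algebraic_int y \<Longrightarrow> x * y \<in> P \<Longrightarrow> x \<in> P \<or> y \<in> P"
proof -
  interpret primeideal P ring_of_integers by fact
  show "ideal P ring_of_integers" ..
  show "1 \<notin> P" using one_imp_carrier I_notcarr by auto
  show "algebraic_int x \<Longrightarrow> algebraic_int y \<Longrightarrow> x * y \<in> P \<Longrightarrow> x \<in> P \<or> y \<in> P"
    using I_prime[of x y] by simp
qed

lemma primeideal_OK_power:
  assumes "primeideal P ring_of_integers" "algebraic_int x" "x ^ n \<in> P"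
  shows "x \<in> P"
  using assms(3)
proof (induction n)
  case 0
  then show ?case using primeideal_OK(2)[OF assms(1)] by simp
next
  case (Suc n)
  then show ?case using primeideal_OK(3)[OF assms(1,2) algebraic_int_power[OF assms(2)], of n] by auto
qed

text \<open>The terms below the lowest coefficient \<open>c\<close> that is prime to \<open>p\<close> go into the multiple of \<open>p\<close>; the
  index of \<open>c\<close> is \<open>i\<close>.\<close>

lemma poly_split_off_prime:
  fixes x :: "'k::field_char_0" and p :: int
  assumes x: "algebraic_int x" and f: "\<exists>i. \<not> p dvd coeff f i"
  shows "\<exists>i c h g. \<not> p dvd c \<and> algebraic_int h \<and> algebraic_int g \<and>
    poly (map_poly of_int f) x = of_int p * g + x ^ i * (of_int c + x * h)"
  using f
proof (induction f)
  case 0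
  then show ?case by simp
next
  case (pCons c0 f)
  have int: "algebraic_int (poly (map_poly of_int f) x)" for f
    by (induction f) (auto simp: map_poly_pCons x)
  have eval: "poly (map_poly of_int (pCons c0 f)) x = of_int c0 + x * poly (map_poly of_int f) x"
    using pCons.hyps by (simp add: map_poly_pCons)
  show ?case
  proof (cases "p dvd c0")
    case False
    have "poly (map_poly of_int (pCons c0 f)) x =
        of_int p * 0 + x ^ 0 * (of_int c0 + x * poly (map_poly of_int f) x)"
      by (simp add: eval)
    then show ?thesis using False int[of f] algebraic_int_0 by blast
  next
    case True
    then obtain m where m: "c0 = p * m" by auto
    have "\<exists>i. \<not> p dvd coeff f i"
    proof -
      obtain i where "\<not> p dvd coeff (pCons c0 f) i" using pCons.prems by blast
      then show ?thesis using True by (cases i) auto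
    qed
    then obtain i c h g where IH: "\<not> p dvd c" "algebraic_int h" "algebraic_int g"
      "poly (map_poly of_int f) x = of_int p * g + x ^ i * (of_int c + x * h)"
      using pCons.IH by blast
    have "poly (map_poly of_int (pCons c0 f)) x = of_int p * (of_int m + x * g) + x ^ Suc i * (of_int c + x * h)"
      unfolding eval by (simp add: IH(4) m algebra_simps)
    moreover have "algebraic_int (of_int m + x * g)" using x IH by auto
    ultimately show ?thesis using IH by blast
  qed
qed

text \<open>Applied to an element of a prime ideal above \<open>p\<close>, this bounds valuations: \<open>c + x h\<close> is a local unit,
  so \<open>p\<close> divides a power of \<open>x\<close> locally. Applied to an element outside, it makes the element invertible
  modulo that prime.\<close>

lemma prime_absorbs_power:
  fixes x :: "'k::field_char_0" and p :: int
  assumes x: "algebraic_int x" and p: "normalization_semidom_class.prime p"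
  obtains i c h g where "\<not> p dvd c" "algebraic_int h" "algebraic_int g"
    "x ^ i * (of_int c + x * h) = of_int p * g"
proof -
  obtain f where f: "poly (map_poly of_int f) x = 0" "lead_coeff f = 1"
    using x algebraic_int_altdef_ipoly by blast
  have "\<not> p dvd coeff f (degree f)" using f(2) p by auto
  then obtain i c h g where "\<not> p dvd c" "algebraic_int h" "algebraic_int g"
    "0 = of_int p * g + x ^ i * (of_int c + x * h)"
    using poly_split_off_prime[OF x, of p f] f(1) by auto
  then show ?thesis using that[of c h "- g" i] by (auto simp: add_eq_0_iff algebraic_int_minus)
qed

text \<open>The lowest nonzero coefficient of an integral equation for \<open>z\<close> is a multiple of \<open>z\<close>.\<close>

lemma algebraic_int_dvd_int:
  fixes z :: "'k::field_char_0"
  assumes z: "algebraic_int z" "z \<noteq> 0"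
  shows "\<exists>(n::int) r. n \<noteq> 0 \<and> algebraic_int r \<and> of_int n = z * r"
proof -
  have *: "\<exists>(n::int) r. n \<noteq> 0 \<and> algebraic_int r \<and> of_int n = z * r"
    if "f \<noteq> 0" "poly (map_poly of_int f) z = 0" for f
    using that
  proof (induction f)
    case (pCons c f)
    have int: "algebraic_int (poly (map_poly of_int f) z)" for f
      by (induction f) (auto simp: map_poly_pCons z)
    show ?case
    proof (cases "c = 0")
      case True
      then show ?thesis using pCons z by (auto simp: map_poly_pCons)
    next
      case False
      then show ?thesis using pCons.prems int[of f]
        by (intro exI[of _ c] exI[of _ "- poly (map_poly of_int f) z"])
          (simp add: map_poly_pCons add_eq_0_iff2)
    qed
  qed simp
  obtain f where f: "poly (map_poly of_int f) z = 0" "lead_coeff f = 1"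
    using z algebraic_int_altdef_ipoly by blast
  then have "f \<noteq> 0" by auto
  then show ?thesis using * f by blast
qed

lemma primeideal_contains_prime:
  assumes P: "primeideal P ring_of_integers" "P \<noteq> {0}"
  obtains p :: int where "normalization_semidom_class.prime p" "of_int p \<in> P"
proof -
  note I = ideal_OK[OF primeideal_OK(1)[OF P(1)]]
  obtain z where z: "z \<in> P" "z \<noteq> 0" using P I(2) by blast
  obtain n :: int and r where n: "n \<noteq> 0" "algebraic_int r" "of_int n = z * r"
    using algebraic_int_dvd_int[OF I(1)[OF z(1)] z(2)] by blast
  then have nP: "of_int n \<in> P" using I z by auto
  have fac: "\<exists>p. p \<in> prime_factors n \<and> of_int p \<in> P"
  proof -
    have prod: "\<exists>p\<in>set_mset M. of_int p \<in> P" if "of_int (prod_mset M) \<in> P" for M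
      using that
    proof (induction M)
      case empty
      then show ?case using primeideal_OK(2)[OF P(1)] by simp
    next
      case (add p M)
      then show ?case using primeideal_OK(3)[OF P(1), of "of_int p" "of_int (prod_mset M)"] by auto
    qed
    have "(of_int (normalize n)) \<in> P"
      using nP I(4)[of "-1" "of_int n"] by (auto simp: abs_if)
    then have "of_int (prod_mset (prime_factorization n)) \<in> P"
      using prod_mset_prime_factorization[OF n(1)] by simp
    then show ?thesis using prod by blast
  qed
  then show ?thesis using that by (meson in_prime_factors_imp_prime)
qed

text \<open>With \<open>p\<close> a rational prime in \<open>P\<close>, some \<open>x\<^sup>i (c + x h)\<close> lies in \<open>P\<close> although \<open>x\<^sup>i\<close> does not. So
  \<open>- x h\<close> is congruent to \<open>c\<close>, an integer prime to \<open>p\<close>, which is invertible modulo \<open>p\<close>.\<close>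

lemma primeideal_maximal:
  fixes x :: "'k::field_char_0"
  assumes P: "primeideal P ring_of_integers" "P \<noteq> {0}" and x: "algebraic_int x" "x \<notin> P"
  obtains r where "algebraic_int r" "1 - r * x \<in> P"
proof -
  note I = ideal_OK[OF primeideal_OK(1)[OF P(1)]]
  obtain p where p: "normalization_semidom_class.prime p" "of_int p \<in> P" using primeideal_contains_prime[OF P] .
  obtain i c h g where icgh: "\<not> p dvd c" "algebraic_int h" "algebraic_int g"
    "x ^ i * (of_int c + x * h) = of_int p * g"
    using prime_absorbs_power[OF x(1) p(1)] .
  have "x ^ i \<notin> P" using primeideal_OK_power[OF P(1) x(1)] x(2) by blast
  moreover have "x ^ i * (of_int c + x * h) \<in> P" using icgh I p by auto
  ultimately have y: "of_int c + x * h \<in> P"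
    using primeideal_OK(3)[OF P(1)] x icgh by (meson algebraic_int_add algebraic_int_mult algebraic_int_of_int algebraic_int_power)
  have "coprime c p" using prime_imp_coprime[OF p(1) icgh(1)] by (simp add: coprime_commute)
  then obtain u v where "u * c + v * p = 1" by (metis bezout_int coprime_imp_gcd_eq_1)
  then have "of_int u * of_int c + of_int v * of_int p = (1 :: 'k)"
    by (metis of_int_1 of_int_add of_int_mult)
  then have eq: "1 - (- of_int u * h) * x = of_int u * (of_int c + x * h) + of_int v * of_int p"
    by (simp add: algebra_simps)
  have "of_int u * (of_int c + x * h) + of_int v * of_int p \<in> P" using y p I by auto
  then have "1 - (- of_int u * h) * x \<in> P" unfolding eq .
  moreover have "algebraic_int (- of_int u * h)" using icgh by auto
  ultimately show ?thesis using that by blast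
qed

lemma primeideal_subset_eq:
  assumes P: "primeideal P ring_of_integers" "P \<noteq> {0}" and Q: "primeideal Q ring_of_integers" "P \<subseteq> Q"
  shows "P = Q"
proof (rule ccontr)
  note I = ideal_OK[OF primeideal_OK(1)[OF Q(1)]]
  assume "P \<noteq> Q"
  then obtain x where x: "x \<in> Q" "x \<notin> P" using Q by blast
  obtain r where "algebraic_int r" "1 - r * x \<in> P" using primeideal_maximal[OF P I(1)[OF x(1)] x(2)] .
  then have "(1 - r * x) + r * x \<in> Q" using Q(2) x I by blast
  then show False using primeideal_OK(2)[OF Q(1)] by simp
qed

section \<open>Products of prime ideals\<close>

lemma ideals_set_simps [simp]:
  "I \<in> carrier (ideals_set R) \<longleftrightarrow> ideal I R" "I \<otimes>\<^bsub>ideals_set R\<^esub> J = ideal_prod R I J"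
  "\<one>\<^bsub>ideals_set R\<^esub> = carrier R"
  by (simp_all add: ideals_set_def)

interpretation OKideals: comm_monoid "ideals_set ring_of_integers"
  by (rule OK.ideals_set_is_comm_monoid)

lemma ideal_prod_OK: "x \<in> I \<Longrightarrow> y \<in> J \<Longrightarrow> x * y \<in> ideal_prod ring_of_integers I J"
  using ideal_prod.prod[of x I y J ring_of_integers] by simp

abbreviation ideal_product :: "'k::field_char_0 set set \<Rightarrow> 'k set" where
  "ideal_product S \<equiv> finprod (ideals_set ring_of_integers) (\<lambda>P. P) S"

lemma ideal_product_insert:
  assumes "finite S" "P \<notin> S" "\<And>Q. Q \<in> insert P S \<Longrightarrow> primeideal Q ring_of_integers"
  shows "ideal_product (insert P S) = ideal_prod ring_of_integers P (ideal_product S)"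
proof -
  have "ideal Q ring_of_integers" if "Q \<in> insert P S" for Q
    by (rule primeideal_OK(1)[OF assms(3)[OF that]])
  then have "(\<lambda>P. P) \<in> S \<rightarrow> carrier (ideals_set ring_of_integers)" "ideal P ring_of_integers"
    by auto
  then show ?thesis using OKideals.finprod_insert[OF assms(1,2), of "\<lambda>P. P"] by simp
qed

lemma ideal_ideal_product:
  assumes "\<And>Q. Q \<in> S \<Longrightarrow> primeideal Q ring_of_integers"
  shows "ideal (ideal_product S) ring_of_integers"
proof -
  have "ideal Q ring_of_integers" if "Q \<in> S" for Q
    by (rule primeideal_OK(1)[OF assms[OF that]])
  then have "(\<lambda>P. P) \<in> S \<rightarrow> carrier (ideals_set ring_of_integers)"
    by auto
  then show ?thesis using OKideals.finprod_closed[of "\<lambda>P. P" S] by simp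
qed

lemma ideal_product_avoids_prime:
  assumes "finite S" "\<And>Q. Q \<in> S \<Longrightarrow> primeideal Q ring_of_integers"
    and P: "primeideal P ring_of_integers" and "\<And>Q. Q \<in> S \<Longrightarrow> \<not> Q \<subseteq> P"
  shows "\<exists>s \<in> ideal_product S. s \<notin> P"
  using assms(1,2,4)
proof (induction S)
  case empty
  then show ?case using primeideal_OK(2)[OF P] by (intro bexI[of _ 1]) auto
next
  case (insert Q S)
  then obtain s where s: "s \<in> ideal_product S" "s \<notin> P" by auto
  obtain q where q: "q \<in> Q" "q \<notin> P" using insert.prems by blast
  have "algebraic_int s" "algebraic_int q"
    using ideal_OK(1)[OF ideal_ideal_product s(1)] ideal_OK(1)[OF primeideal_OK(1) q(1)] insert.prems by auto
  then have "q * s \<notin> P" using primeideal_OK(3)[OF P, of q s] s q by auto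
  moreover have "q * s \<in> ideal_product (insert Q S)"
    using ideal_product_insert[OF insert.hyps(1,2) insert.prems(1)] ideal_prod_OK[OF q(1) s(1)] by simp
  ultimately show ?case by blast
qed

text \<open>A form of the Chinese remainder theorem: each \<open>Q\<close> is maximal, hence contains an element congruent to
  1 modulo \<open>J\<close>, and \<open>z\<close> is the product of these. If \<open>J\<close> contains the product of the ideals, it is the
  unit ideal.\<close>

lemma unit_ideal_from_local:
  assumes "finite S" "\<And>Q. Q \<in> S \<Longrightarrow> primeideal Q ring_of_integers \<and> Q \<noteq> {0}"
    and J: "ideal J ring_of_integers" and "\<And>Q. Q \<in> S \<Longrightarrow> \<not> J \<subseteq> Q"
  shows "\<exists>z \<in> ideal_product S. 1 - z \<in> J"
  using assms(1,2,4)
proof (induction S)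
  case empty
  then show ?case using ideal_OK(2)[OF J] by (intro bexI[of _ 1]) auto
next
  case (insert Q S)
  then obtain z where z: "z \<in> ideal_product S" "1 - z \<in> J" by auto
  have Q: "primeideal Q ring_of_integers" "Q \<noteq> {0}" using insert.prems by auto
  obtain x where x: "x \<in> J" "x \<notin> Q" using insert.prems by blast
  note J' = ideal_OK[OF J]
  obtain r where r: "algebraic_int r" "1 - r * x \<in> Q" using primeideal_maximal[OF Q J'(1)[OF x(1)] x(2)] .
  then have "(1 - r * x) * z \<in> ideal_product (insert Q S)"
    using z insert.prems by (subst ideal_product_insert[OF insert.hyps(1,2)]) (auto intro: ideal_prod_OK)
  moreover have "1 - (1 - r * x) * z = r * x + (1 - r * x) * (1 - z)" by (simp add: algebra_simps)
  moreover have "r * x + (1 - r * x) * (1 - z) \<in> J"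
    using r z x J' ideal_OK(1)[OF primeideal_OK(1)[OF Q(1)] r(2)] by blast
  ultimately show ?case by metis
qed

section \<open>The local ring at a prime with a uniformizer\<close>

text \<open>The last assumption says that \<open>\<pi>\<close> generates \<open>P\<close> after localization. It is stated with one
  denominator \<open>s\<close> for all of \<open>P\<close>; such an \<open>s\<close> is at hand when \<open>\<pi>\<close> generates a product of \<open>P\<close> with
  other primes.\<close>

locale prime_uniformizer =
  fixes P :: "'k::field_char_0 set" and \<pi> :: 'k
  assumes number_field: "number_field TYPE('k)"
    and prime: "primeideal P ring_of_integers"
    and pi: "\<pi> \<in> P" "\<pi> \<noteq> 0"
    and uniformizing: "\<exists>s. algebraic_int s \<and> s \<notin> P \<and> (\<forall>x\<in>P. \<exists>r. algebraic_int r \<and> s * x = \<pi> * r)"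
begin

lemmas P_ideal = ideal_OK[OF primeideal_OK(1)[OF prime]]
lemmas one_notin_P = primeideal_OK(2)[OF prime]
lemmas P_prime = primeideal_OK(3)[OF prime]

definition Loc :: "'k set" where
  "Loc = {x. \<exists>s. algebraic_int s \<and> s \<notin> P \<and> algebraic_int (s * x)}"

lemma LocI: "algebraic_int s \<Longrightarrow> s \<notin> P \<Longrightarrow> algebraic_int (s * x) \<Longrightarrow> x \<in> Loc"
  by (auto simp: Loc_def)

lemma Loc_algebraic_int [simp]: "algebraic_int x \<Longrightarrow> x \<in> Loc"
  by (rule LocI[of 1]) (auto simp: one_notin_P)

lemma Loc_add [simp]:
  assumes "x \<in> Loc" "y \<in> Loc"
  shows "x + y \<in> Loc"
proof -
  obtain s t where st: "algebraic_int s" "s \<notin> P" "algebraic_int (s * x)"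
    "algebraic_int t" "t \<notin> P" "algebraic_int (t * y)"
    using assms by (auto simp: Loc_def)
  have "s * t * (x + y) = t * (s * x) + s * (t * y)" by (simp add: algebra_simps)
  then have "algebraic_int (s * t * (x + y))" using st by simp
  then show ?thesis using st P_prime by (intro LocI[of "s * t"]) auto
qed

lemma Loc_mult [simp]:
  assumes "x \<in> Loc" "y \<in> Loc"
  shows "x * y \<in> Loc"
proof -
  obtain s t where st: "algebraic_int s" "s \<notin> P" "algebraic_int (s * x)"
    "algebraic_int t" "t \<notin> P" "algebraic_int (t * y)"
    using assms by (auto simp: Loc_def)
  have eq: "s * t * (x * y) = (s * x) * (t * y)" by (simp add: algebra_simps)
  have "algebraic_int (s * t * (x * y))" unfolding eq using st by simp
  then show ?thesis using st P_prime by (intro LocI[of "s * t"]) auto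
qed

lemma Loc_uminus [simp]: "x \<in> Loc \<Longrightarrow> - x \<in> Loc"
  using Loc_mult[of "-1" x] by simp

lemma Loc_diff [simp]: "x \<in> Loc \<Longrightarrow> y \<in> Loc \<Longrightarrow> x - y \<in> Loc"
  using Loc_add[of x "- y"] by simp

lemma Loc_power [simp]: "x \<in> Loc \<Longrightarrow> x ^ n \<in> Loc"
  by (induction n) auto

lemma Loc_pi [simp]: "\<pi> \<in> Loc"
  using P_ideal(1) pi by simp

lemma Loc_inverse: "algebraic_int s \<Longrightarrow> s \<notin> P \<Longrightarrow> 1 / s \<in> Loc"
  using P_ideal(2) by (intro LocI[of s]) auto

lemma in_P_iff:
  assumes "algebraic_int x"
  shows "x \<in> P \<longleftrightarrow> x / \<pi> \<in> Loc"
proof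
  assume "x \<in> P"
  obtain s r where "algebraic_int s" "s \<notin> P" "algebraic_int r" "s * x = \<pi> * r"
    using uniformizing \<open>x \<in> P\<close> by blast
  then show "x / \<pi> \<in> Loc" using pi by (intro LocI[of s]) auto
next
  assume "x / \<pi> \<in> Loc"
  then obtain s where s: "algebraic_int s" "s \<notin> P" "algebraic_int (s * (x / \<pi>))"
    by (auto simp: Loc_def)
  have "s * x = \<pi> * (s * (x / \<pi>))" using pi by simp
  then have "s * x \<in> P" using P_ideal(5)[OF s(3) pi(1)] by simp
  then show "x \<in> P" using P_prime[OF s(1) assms] s by blast
qed

lemma inverse_pi_notin_Loc: "1 / \<pi> \<notin> Loc"
  using in_P_iff[of 1] one_notin_P by simp

text \<open>\<open>Loc\<close> is a local ring with maximal ideal generated by \<open>\<pi>\<close>.\<close>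

lemma Loc_unit:
  assumes "x \<in> Loc" "x / \<pi> \<notin> Loc"
  shows "1 / x \<in> Loc"
proof -
  obtain s where s: "algebraic_int s" "s \<notin> P" "algebraic_int (s * x)"
    using assms(1) by (auto simp: Loc_def)
  have "s \<noteq> 0" using s(2) P_ideal(2) by auto
  have "s * x \<notin> P"
  proof
    assume "s * x \<in> P"
    then have "(1 / s) * (s * x / \<pi>) \<in> Loc"
      using in_P_iff[OF s(3)] Loc_inverse[OF s(1,2)] by (intro Loc_mult) auto
    then show False using assms(2) \<open>s \<noteq> 0\<close> by simp
  qed
  then have "1 / (s * x) * s \<in> Loc" using Loc_inverse[OF s(3)] s(1) by (intro Loc_mult) auto
  then show ?thesis using \<open>s \<noteq> 0\<close> by simp
qed

lemma Loc_common_denominator: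
  assumes "finite Y" "Y \<subseteq> Loc"
  shows "\<exists>s. algebraic_int s \<and> s \<notin> P \<and> (\<forall>x\<in>Y. algebraic_int (s * x))"
  using assms
proof (induction Y)
  case empty
  then show ?case using one_notin_P by (intro exI[of _ 1]) auto
next
  case (insert x Y)
  then obtain s t where st: "algebraic_int s" "s \<notin> P" "\<forall>x\<in>Y. algebraic_int (s * x)"
    "algebraic_int t" "t \<notin> P" "algebraic_int (t * x)"
    by (auto simp: Loc_def)
  have "algebraic_int (s * t * y)" if "y \<in> insert x Y" for y
  proof (cases "y = x")
    case True
    then show ?thesis using st algebraic_int_mult[of s "t * x"] by (simp add: mult.assoc)
  next
    case False
    have eq: "s * t * y = t * (s * y)" by (simp add: mult_ac)
    show ?thesis unfolding eq using False that st by simp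
  qed
  moreover have "s * t \<notin> P" using P_prime st by blast
  ultimately show ?case using st by (intro exI[of _ "s * t"]) auto
qed

abbreviation P_power :: "nat \<Rightarrow> 'k set" where
  "P_power n \<equiv> P [^]\<^bsub>ideals_set ring_of_integers\<^esub> n"

lemma ideal_P_power: "ideal (P_power n) ring_of_integers"
  using OKideals.nat_pow_closed[of P n] primeideal_OK(1)[OF prime] by simp

lemma P_power_Suc: "P_power (Suc n) = ideal_prod ring_of_integers (P_power n) P"
  by simp

lemma P_power_le:
  assumes "y \<in> P_power n"
  shows "y / \<pi> ^ n \<in> Loc"
  using assms
proof (induction n arbitrary: y)
  case 0
  then show ?case by simp
next
  case (Suc n)
  have "y \<in> ideal_prod ring_of_integers (P_power n) P" using Suc.prems unfolding P_power_Suc .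
  then show ?case
  proof induction
    case (prod i j)
    have "(i / \<pi> ^ n) * (j / \<pi>) \<in> Loc"
      using Suc.IH[OF prod(1)] in_P_iff[OF P_ideal(1)[OF prod(2)]] prod(2) by (intro Loc_mult) auto
    then show ?case by (simp add: field_simps)
  next
    case (sum x y)
    then show ?case by (simp add: add_divide_distrib)
  qed
qed

lemma pi_power_in_P_power: "\<pi> ^ n \<in> P_power n"
proof (induction n)
  case (Suc n)
  then show ?case unfolding P_power_Suc using ideal_prod_OK[OF Suc pi(1)] by (simp add: mult.commute)
qed simp

text \<open>From \<open>s P \<subseteq> \<pi> R\<close> with \<open>s\<close> outside \<open>P\<close>, the ideals \<open>P\<^sup>n\<close> and \<open>\<pi>\<^sup>n R\<close> agree locally; all
  statements about the \<open>P\<close>-adic topology become divisibility by \<open>\<pi>\<^sup>n\<close> in \<open>Loc\<close>.\<close>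

lemma padic_ball_iff: "x \<in> padic_ball P n \<longleftrightarrow> x / \<pi> ^ n \<in> Loc"
proof
  assume "x \<in> padic_ball P n"
  then obtain s where s: "algebraic_int s" "s \<notin> P" "s * x \<in> P_power n"
    by (auto simp: padic_ball_def)
  have "s \<noteq> 0" using s(2) P_ideal(2) by auto
  have "1 / s * (s * x / \<pi> ^ n) \<in> Loc" by (rule Loc_mult[OF Loc_inverse[OF s(1,2)] P_power_le[OF s(3)]])
  then show "x / \<pi> ^ n \<in> Loc" using \<open>s \<noteq> 0\<close> by simp
next
  assume "x / \<pi> ^ n \<in> Loc"
  then obtain s where s: "algebraic_int s" "s \<notin> P" "algebraic_int (s * (x / \<pi> ^ n))"
    by (auto simp: Loc_def)
  have "s * x = (s * (x / \<pi> ^ n)) * \<pi> ^ n" using pi by simp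
  then have "s * x \<in> P_power n"
    using ideal_OK(4)[OF ideal_P_power s(3) pi_power_in_P_power] by metis
  then show "x \<in> padic_ball P n" using s by (auto simp: padic_ball_def)
qed

text \<open>This says that \<open>P\<close>-adic valuations are finite. A rational prime \<open>p\<close> in \<open>P\<close> divides a power of
  \<open>\<pi>\<close> in \<open>Loc\<close>, other rational primes are units there, and each field element has an integer as
  denominator.\<close>

lemma pi_power_clears_denominator: "\<exists>N. \<pi> ^ N * x \<in> Loc"
proof -
  obtain p :: int where p: "normalization_semidom_class.prime p" "of_int p \<in> P"
    using primeideal_contains_prime[OF prime] pi by blast
  have int_notin: "of_int c \<notin> P" if "\<not> p dvd c" for c
  proof
    assume "of_int c \<in> P"
    have "coprime c p" using prime_imp_coprime[OF p(1) that] by (simp add: coprime_commute)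
    then obtain u v where "u * c + v * p = 1" by (metis bezout_int coprime_imp_gcd_eq_1)
    then have "of_int u * of_int c + of_int v * of_int p = (1 :: 'k)"
      by (metis of_int_1 of_int_add of_int_mult)
    moreover have "of_int u * of_int c + of_int v * of_int p \<in> P"
      using \<open>of_int c \<in> P\<close> p P_ideal by auto
    ultimately show False using one_notin_P by simp
  qed
  obtain i c h g where icgh: "\<not> p dvd c" "algebraic_int h" "algebraic_int g"
    "\<pi> ^ i * (of_int c + \<pi> * h) = of_int p * g"
    using prime_absorbs_power[OF P_ideal(1)[OF pi(1)] p(1)] .
  have unit: "of_int c + \<pi> * h \<notin> P"
  proof
    assume "of_int c + \<pi> * h \<in> P"
    then have "of_int c + \<pi> * h - \<pi> * h \<in> P"
      by (rule P_ideal(6)) (rule P_ideal(5)[OF icgh(2) pi(1)])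
    then show False using int_notin[OF icgh(1)] by simp
  qed
  have "of_int p \<noteq> (0::'k)" using p(1) by auto
  have unit0: "of_int c + \<pi> * h \<noteq> 0" using unit P_ideal(2) by auto
  have "g * (1 / (of_int c + \<pi> * h)) \<in> Loc"
    using Loc_inverse[OF _ unit] icgh P_ideal(1)[OF pi(1)] by (intro Loc_mult) auto
  also have "g * (1 / (of_int c + \<pi> * h)) = \<pi> ^ i / of_int p"
    using icgh(4) unit0 \<open>of_int p \<noteq> 0\<close> by (simp add: field_simps)
  finally have pip: "\<pi> ^ i / of_int p \<in> Loc" .
  have int: "\<exists>N. \<pi> ^ N / of_int n \<in> Loc" if "n \<noteq> 0" for n :: int
    using that
  proof (induction "nat \<bar>n\<bar>" arbitrary: n rule: less_induct)
    case less
    show ?case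
    proof (cases "p dvd n")
      case False
      then show ?thesis using Loc_inverse[OF _ int_notin[OF False]] by (intro exI[of _ 0]) simp
    next
      case True
      then obtain k where k: "n = p * k" by auto
      have "1 < p" using p(1) by (rule prime_gt_1_int)
      have "nat \<bar>k\<bar> < nat \<bar>n\<bar>" using k less.prems \<open>1 < p\<close> by (auto simp: abs_mult)
      then obtain N where N: "\<pi> ^ N / of_int k \<in> Loc" using less.hyps[of k] k less.prems by auto
      have "\<pi> ^ (N + i) / of_int n = (\<pi> ^ N / of_int k) * (\<pi> ^ i / of_int p)"
        by (simp add: k power_add)
      then show ?thesis using Loc_mult[OF N pip] by metis
    qed
  qed
  obtain n :: int where n: "n \<noteq> 0" "algebraic_int (of_int n * x)"
    using number_field_denominator[OF number_field] by blast
  obtain N where N: "\<pi> ^ N / of_int n \<in> Loc" using int[OF n(1)] by blast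
  have "(\<pi> ^ N / of_int n) * (of_int n * x) \<in> Loc" by (rule Loc_mult[OF N Loc_algebraic_int[OF n(2)]])
  moreover have "(\<pi> ^ N / of_int n) * (of_int n * x) = \<pi> ^ N * x" using n(1) by simp
  ultimately show ?thesis by metis
qed

section \<open>Square roots in the completion\<close>

lemma Loc_div_power_mono:
  assumes "x / \<pi> ^ n \<in> Loc" "m \<le> n"
  shows "x / \<pi> ^ m \<in> Loc"
proof -
  have "x / \<pi> ^ m = x / \<pi> ^ n * \<pi> ^ (n - m)"
    using assms(2) pi by (simp add: field_simps flip: power_add)
  then show ?thesis using Loc_mult[OF assms(1) Loc_power[OF Loc_pi]] by simp
qed

lemma padic_cauchy_iff:
  "u \<in> padic_cauchy P \<longleftrightarrow> (\<forall>n. \<exists>N. \<forall>l\<ge>N. \<forall>m\<ge>N. (u l - u m) / \<pi> ^ n \<in> Loc)"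
  by (simp add: padic_cauchy_def padic_ball_iff)

lemma padic_null_iff:
  "u \<in> padic_null P \<longleftrightarrow> (\<forall>n. \<exists>N. \<forall>m\<ge>N. u m / \<pi> ^ n \<in> Loc)"
  by (simp add: padic_null_def padic_ball_iff)

text \<open>Boundedness is what makes products of Cauchy sequences Cauchy and null sequences an ideal.\<close>

lemma padic_cauchy_bounded:
  assumes "u \<in> padic_cauchy P"
  shows "\<exists>A N. \<forall>m\<ge>N. \<pi> ^ A * u m \<in> Loc"
proof -
  obtain N where N: "\<And>l m. l \<ge> N \<Longrightarrow> m \<ge> N \<Longrightarrow> (u l - u m) / \<pi> ^ 0 \<in> Loc"
    using assms unfolding padic_cauchy_iff by blast
  obtain A where A: "\<pi> ^ A * u N \<in> Loc" using pi_power_clears_denominator by blast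
  have "\<pi> ^ A * u m \<in> Loc" if "m \<ge> N" for m
  proof -
    have "\<pi> ^ A * u m = \<pi> ^ A * (u m - u N) + \<pi> ^ A * u N" by (simp add: algebra_simps)
    moreover have "\<pi> ^ A * (u m - u N) \<in> Loc" using N[OF that, of N] by simp
    ultimately show ?thesis using A by simp
  qed
  then show ?thesis by blast
qed

lemma Loc_mult_div_power:
  assumes "\<pi> ^ A * x \<in> Loc" "y / \<pi> ^ (n + A) \<in> Loc"
  shows "x * y / \<pi> ^ n \<in> Loc"
  using Loc_mult[OF assms] pi by (simp add: power_add field_simps)

lemma padic_cauchy_mult:
  assumes u: "u \<in> padic_cauchy P" and v: "v \<in> padic_cauchy P"
  shows "(\<lambda>n. u n * v n) \<in> padic_cauchy P"
  unfolding padic_cauchy_iff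
proof
  fix n
  obtain A M where A: "\<And>m. m \<ge> M \<Longrightarrow> \<pi> ^ A * u m \<in> Loc" using padic_cauchy_bounded[OF u] by blast
  obtain B M' where B: "\<And>m. m \<ge> M' \<Longrightarrow> \<pi> ^ B * v m \<in> Loc" using padic_cauchy_bounded[OF v] by blast
  obtain N where N: "\<And>l m. l \<ge> N \<Longrightarrow> m \<ge> N \<Longrightarrow> (u l - u m) / \<pi> ^ (n + B) \<in> Loc"
    using u unfolding padic_cauchy_iff by blast
  obtain N' where N': "\<And>l m. l \<ge> N' \<Longrightarrow> m \<ge> N' \<Longrightarrow> (v l - v m) / \<pi> ^ (n + A) \<in> Loc"
    using v unfolding padic_cauchy_iff by blast
  have "(u l * v l - u m * v m) / \<pi> ^ n \<in> Loc"
    if "l \<ge> Max {M, M', N, N'}" "m \<ge> Max {M, M', N, N'}" for l m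
  proof -
    have "u l * v l - u m * v m = u l * (v l - v m) + v m * (u l - u m)" by (simp add: algebra_simps)
    then have "(u l * v l - u m * v m) / \<pi> ^ n = u l * (v l - v m) / \<pi> ^ n + v m * (u l - u m) / \<pi> ^ n"
      by (simp add: add_divide_distrib)
    moreover have "u l * (v l - v m) / \<pi> ^ n \<in> Loc"
      using that by (intro Loc_mult_div_power[of A] A N') auto
    moreover have "v m * (u l - u m) / \<pi> ^ n \<in> Loc"
      using that by (intro Loc_mult_div_power[of B] B N) auto
    ultimately show ?thesis by simp
  qed
  then show "\<exists>N. \<forall>l\<ge>N. \<forall>m\<ge>N. (u l * v l - u m * v m) / \<pi> ^ n \<in> Loc" by blast
qed

lemma padic_cauchy_add:
  assumes u: "u \<in> padic_cauchy P" and v: "v \<in> padic_cauchy P"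
  shows "(\<lambda>n. u n + v n) \<in> padic_cauchy P"
  unfolding padic_cauchy_iff
proof
  fix n
  obtain N where N: "\<And>l m. l \<ge> N \<Longrightarrow> m \<ge> N \<Longrightarrow> (u l - u m) / \<pi> ^ n \<in> Loc"
    using u unfolding padic_cauchy_iff by blast
  obtain N' where N': "\<And>l m. l \<ge> N' \<Longrightarrow> m \<ge> N' \<Longrightarrow> (v l - v m) / \<pi> ^ n \<in> Loc"
    using v unfolding padic_cauchy_iff by blast
  have "(u l + v l - (u m + v m)) / \<pi> ^ n \<in> Loc"
    if "l \<ge> max N N'" "m \<ge> max N N'" for l m
  proof -
    have "(u l + v l - (u m + v m)) / \<pi> ^ n = (u l - u m) / \<pi> ^ n + (v l - v m) / \<pi> ^ n"
      by (simp add: algebra_simps diff_divide_distrib add_divide_distrib)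
    then show ?thesis using that N N' by simp
  qed
  then show "\<exists>N. \<forall>l\<ge>N. \<forall>m\<ge>N. (u l + v l - (u m + v m)) / \<pi> ^ n \<in> Loc" by blast
qed

lemma padic_cauchy_const: "(\<lambda>_. c) \<in> padic_cauchy P"
  by (simp add: padic_cauchy_iff)

lemma padic_null_subset_cauchy: "padic_null P \<subseteq> padic_cauchy P"
proof
  fix u assume "u \<in> padic_null P"
  show "u \<in> padic_cauchy P"
    unfolding padic_cauchy_iff
  proof
    fix n
    obtain N where "\<And>m. m \<ge> N \<Longrightarrow> u m / \<pi> ^ n \<in> Loc"
      using \<open>u \<in> padic_null P\<close> unfolding padic_null_iff by blast
    then show "\<exists>N. \<forall>l\<ge>N. \<forall>m\<ge>N. (u l - u m) / \<pi> ^ n \<in> Loc"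
      by (intro exI[of _ N]) (simp add: diff_divide_distrib)
  qed
qed

lemma padic_null_add:
  assumes u: "u \<in> padic_null P" and v: "v \<in> padic_null P"
  shows "(\<lambda>n. u n + v n) \<in> padic_null P"
  unfolding padic_null_iff
proof
  fix n
  obtain N where N: "\<And>m. m \<ge> N \<Longrightarrow> u m / \<pi> ^ n \<in> Loc"
    using u unfolding padic_null_iff by blast
  obtain N' where N': "\<And>m. m \<ge> N' \<Longrightarrow> v m / \<pi> ^ n \<in> Loc"
    using v unfolding padic_null_iff by blast
  show "\<exists>N. \<forall>m\<ge>N. (u m + v m) / \<pi> ^ n \<in> Loc"
    using N N' by (intro exI[of _ "max N N'"]) (simp add: add_divide_distrib)
qed

lemma padic_null_mult:
  assumes u: "u \<in> padic_cauchy P" and v: "v \<in> padic_null P"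
  shows "(\<lambda>n. u n * v n) \<in> padic_null P"
  unfolding padic_null_iff
proof
  fix n
  obtain A M where A: "\<And>m. m \<ge> M \<Longrightarrow> \<pi> ^ A * u m \<in> Loc" using padic_cauchy_bounded[OF u] by blast
  obtain N where N: "\<And>m. m \<ge> N \<Longrightarrow> v m / \<pi> ^ (n + A) \<in> Loc"
    using v unfolding padic_null_iff by blast
  show "\<exists>N. \<forall>m\<ge>N. u m * v m / \<pi> ^ n \<in> Loc"
    using A N by (intro exI[of _ "max M N"]) (auto intro: Loc_mult_div_power[of A])
qed

lemma padic_cauchy_uminus: "u \<in> padic_cauchy P \<Longrightarrow> (\<lambda>n. - u n) \<in> padic_cauchy P"
  using padic_cauchy_mult[OF padic_cauchy_const[of "-1"]] by simp

lemma padic_cauchy_ring_simps [simp]: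
  "carrier (padic_cauchy_ring P) = padic_cauchy P"
  "u \<otimes>\<^bsub>padic_cauchy_ring P\<^esub> v = (\<lambda>n. u n * v n)"
  "u \<oplus>\<^bsub>padic_cauchy_ring P\<^esub> v = (\<lambda>n. u n + v n)"
  "\<one>\<^bsub>padic_cauchy_ring P\<^esub> = (\<lambda>_. 1)"
  "\<zero>\<^bsub>padic_cauchy_ring P\<^esub> = (\<lambda>_. 0)"
  by (simp_all add: padic_cauchy_ring_def)

lemma cring_padic_cauchy_ring: "cring (padic_cauchy_ring P)"
proof (rule cringI)
  show "abelian_group (padic_cauchy_ring P)"
  proof (rule abelian_groupI)
    fix u assume "u \<in> carrier (padic_cauchy_ring P)"
    then show "\<exists>v\<in>carrier (padic_cauchy_ring P). v \<oplus>\<^bsub>padic_cauchy_ring P\<^esub> u = \<zero>\<^bsub>padic_cauchy_ring P\<^esub>"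
      using padic_cauchy_uminus by (intro bexI[of _ "\<lambda>n. - u n"]) auto
  qed (auto simp: padic_cauchy_add padic_cauchy_const algebra_simps)
  show "comm_monoid (padic_cauchy_ring P)"
    by (rule comm_monoidI) (auto simp: padic_cauchy_mult padic_cauchy_const mult_ac)
qed (auto simp: algebra_simps)

lemma ideal_padic_null: "ideal (padic_null P) (padic_cauchy_ring P)"
proof -
  interpret cring "padic_cauchy_ring P" by (rule cring_padic_cauchy_ring)
  have neg: "\<ominus>\<^bsub>padic_cauchy_ring P\<^esub> u = (\<lambda>n. - u n)" if "u \<in> padic_cauchy P" for u
    using that padic_cauchy_uminus by (intro minus_equality) auto
  show ?thesis
  proof (rule idealI)
    show "subgroup (padic_null P) (add_monoid (padic_cauchy_ring P))"
    proof (rule add.subgroupI)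
      show "padic_null P \<noteq> {}" using padic_null_iff[of "\<lambda>_. 0"] by auto
      fix u v assume uv: "u \<in> padic_null P" "v \<in> padic_null P"
      show "u \<oplus>\<^bsub>padic_cauchy_ring P\<^esub> v \<in> padic_null P" using padic_null_add[OF uv] by simp
      show "\<ominus>\<^bsub>padic_cauchy_ring P\<^esub> u \<in> padic_null P"
        using padic_null_mult[OF padic_cauchy_const[of "-1"] uv(1)] uv(1) padic_null_subset_cauchy
        by (subst neg) auto
    qed (use padic_null_subset_cauchy in auto)
  next
    fix u v assume "u \<in> padic_null P" "v \<in> carrier (padic_cauchy_ring P)"
    then have "(\<lambda>n. v n * u n) \<in> padic_null P" by (intro padic_null_mult) auto
    then show "v \<otimes>\<^bsub>padic_cauchy_ring P\<^esub> u \<in> padic_null P" "u \<otimes>\<^bsub>padic_cauchy_ring P\<^esub> v \<in> padic_null P"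
      by (simp_all add: mult.commute)
  qed (rule ring_axioms)
qed

lemma coset_hom_completion:
  "ring_hom_cring (padic_cauchy_ring P) (completion P) (\<lambda>u. padic_null P +>\<^bsub>padic_cauchy_ring P\<^esub> u)"
  unfolding completion_def
  by (rule ideal.rcos_ring_hom_cring[OF ideal_padic_null cring_padic_cauchy_ring])

lemma zero_completion: "\<zero>\<^bsub>completion P\<^esub> = padic_null P"
  by (simp add: completion_def FactRing_def)

lemma square_root_in_completion:
  assumes s: "s \<in> padic_cauchy P" and null: "(\<lambda>n. s n ^ 2 - c) \<in> padic_null P"
  shows "\<exists>r\<in>carrier (completion P). r \<otimes>\<^bsub>completion P\<^esub> r = to_completion P c"
proof -
  interpret \<phi>: ring_hom_cring "padic_cauchy_ring P" "completion P"
    "\<lambda>u. padic_null P +>\<^bsub>padic_cauchy_ring P\<^esub> u"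
    by (rule coset_hom_completion)
  let ?\<phi> = "\<lambda>u. padic_null P +>\<^bsub>padic_cauchy_ring P\<^esub> u"
  interpret I: ideal "padic_null P" "padic_cauchy_ring P" by (rule ideal_padic_null)
  have "?\<phi> s \<otimes>\<^bsub>completion P\<^esub> ?\<phi> s = ?\<phi> (\<lambda>n. s n * s n)"
    using \<phi>.hom_mult[of s s] s by simp
  also have "(\<lambda>n. s n * s n) = (\<lambda>n. s n ^ 2 - c) \<oplus>\<^bsub>padic_cauchy_ring P\<^esub> (\<lambda>_. c)"
    by (simp add: power2_eq_square)
  also have "?\<phi> \<dots> = ?\<phi> (\<lambda>n. s n ^ 2 - c) \<oplus>\<^bsub>completion P\<^esub> ?\<phi> (\<lambda>_. c)"
    using null padic_null_subset_cauchy by (intro \<phi>.hom_add) (auto simp: padic_cauchy_const)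
  also have "?\<phi> (\<lambda>n. s n ^ 2 - c) = \<zero>\<^bsub>completion P\<^esub>"
    unfolding zero_completion by (rule I.a_rcos_const[OF null])
  finally have "?\<phi> s \<otimes>\<^bsub>completion P\<^esub> ?\<phi> s = ?\<phi> (\<lambda>_. c)"
    using \<phi>.hom_closed[of "\<lambda>_. c"] by (simp add: padic_cauchy_const)
  then show ?thesis using \<phi>.hom_closed[of s] s by (auto simp: to_completion_def)
qed

lemma one_neq_zero_completion: "\<one>\<^bsub>completion P\<^esub> \<noteq> \<zero>\<^bsub>completion P\<^esub>"
proof
  interpret \<phi>: ring_hom_cring "padic_cauchy_ring P" "completion P"
    "\<lambda>u. padic_null P +>\<^bsub>padic_cauchy_ring P\<^esub> u"
    by (rule coset_hom_completion)
  interpret I: ideal "padic_null P" "padic_cauchy_ring P" by (rule ideal_padic_null)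
  assume "\<one>\<^bsub>completion P\<^esub> = \<zero>\<^bsub>completion P\<^esub>"
  then have "padic_null P +>\<^bsub>padic_cauchy_ring P\<^esub> (\<lambda>_. 1) = padic_null P"
    using \<phi>.hom_one by (simp add: zero_completion)
  then have "(\<lambda>_. 1) \<in> padic_null P"
    using I.a_rcos_self[of "\<lambda>_. 1"] by (simp add: padic_cauchy_const)
  then obtain N :: nat where "\<forall>m\<ge>N. 1 / \<pi> ^ 1 \<in> Loc" unfolding padic_null_iff by blast
  then show False using inverse_pi_notin_Loc by auto
qed

text \<open>Hensel's lemma for \<open>X\<^sup>2 - c\<close> by the simplified Newton iteration \<open>t \<mapsto> t - (t\<^sup>2 - c) / (2 t0)\<close>,
  whose fixed denominator is a local unit because \<open>2\<close> and \<open>c\<close> are.\<close>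

lemma hensel_square_root:
  assumes c: "algebraic_int c" "c \<notin> P" and two: "2 \<notin> P"
    and t0: "t0 \<in> Loc" "(t0 ^ 2 - c) / \<pi> \<in> Loc"
  shows "\<exists>r\<in>carrier (completion P). r \<otimes>\<^bsub>completion P\<^esub> r = to_completion P c"
proof -
  have "t0 / \<pi> \<notin> Loc"
  proof
    assume "t0 / \<pi> \<in> Loc"
    then have "t0 * (t0 / \<pi>) - (t0 ^ 2 - c) / \<pi> \<in> Loc" using t0 by (intro Loc_diff Loc_mult)
    then have "c / \<pi> \<in> Loc" by (simp add: power2_eq_square diff_divide_distrib)
    then show False using in_P_iff[OF c(1)] c(2) by simp
  qed
  then have "1 / t0 \<in> Loc" "t0 \<noteq> 0" using Loc_unit[OF t0(1)] by auto
  define w where "w = 1 / (2 * t0)"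
  have "(1 / 2) * (1 / t0) \<in> Loc"
    using \<open>1 / t0 \<in> Loc\<close> Loc_inverse[of 2] two by (intro Loc_mult) auto
  then have w: "w \<in> Loc" by (simp add: w_def)
  define t where "t = rec_nat t0 (\<lambda>_ x. x - w * (x ^ 2 - c))"
  have t_Suc: "t (Suc n) = t n - w * (t n ^ 2 - c)" for n by (simp add: t_def)
  have inv: "t n \<in> Loc \<and> (t n - t0) / \<pi> \<in> Loc \<and> (t n ^ 2 - c) / \<pi> ^ Suc n \<in> Loc" for n
  proof (induction n)
    case 0
    then show ?case using t0 by (simp add: t_def)
  next
    case (Suc n)
    define f where "f = t n ^ 2 - c"
    have f: "f / \<pi> ^ Suc n \<in> Loc" using Suc by (simp add: f_def)
    have f1: "f / \<pi> \<in> Loc" using Loc_div_power_mono[OF f, of 1] by simp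
    have f0: "f \<in> Loc" using Suc c by (simp add: f_def)
    have "1 - 2 * t n * w = - 2 * w * (t n - t0)"
      using \<open>t0 \<noteq> 0\<close> by (simp add: w_def field_simps)
    moreover have "t (Suc n) ^ 2 - c = f * (1 - 2 * t n * w) + w ^ 2 * f ^ 2"
      unfolding t_Suc f_def[symmetric] by (simp add: f_def power2_eq_square algebra_simps)
    moreover have "(f * (- 2 * w * e) + w ^ 2 * f ^ 2) / \<pi> ^ Suc (Suc n) =
        (f / \<pi> ^ Suc n) * (- 2 * w * (e / \<pi>)) + w ^ 2 * (f / \<pi> ^ Suc n) * (f / \<pi>)" for e
      using pi by (simp add: field_simps power2_eq_square)
    ultimately have "(t (Suc n) ^ 2 - c) / \<pi> ^ Suc (Suc n) =
        (f / \<pi> ^ Suc n) * (- 2 * w * ((t n - t0) / \<pi>)) + w ^ 2 * (f / \<pi> ^ Suc n) * (f / \<pi>)"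
      by metis
    moreover have "(f / \<pi> ^ Suc n) * (- 2 * w * ((t n - t0) / \<pi>)) + w ^ 2 * (f / \<pi> ^ Suc n) * (f / \<pi>) \<in> Loc"
      using f f1 w Suc by (intro Loc_add Loc_mult) auto
    ultimately have 1: "(t (Suc n) ^ 2 - c) / \<pi> ^ Suc (Suc n) \<in> Loc" by metis
    have "(t n - t0) / \<pi> - w * (f / \<pi>) \<in> Loc" using Suc w f1 by (intro Loc_diff Loc_mult) auto
    then have 2: "(t (Suc n) - t0) / \<pi> \<in> Loc"
      unfolding t_Suc f_def[symmetric] by (simp add: diff_divide_distrib add_divide_distrib algebra_simps)
    have "t (Suc n) \<in> Loc" unfolding t_Suc f_def[symmetric] using f0 w Suc by simp
    then show ?case using 1 2 by blast
  qed
  \<comment> \<open>Successive iterates differ by a multiple of \<open>\<pi>\<^sup>n\<^sup>+\<^sup>1\<close>, so the iteration converges.\<close>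
  have step: "(t m - t n) / \<pi> ^ n \<in> Loc" if "n \<le> m" for m n
    using that
  proof (induction m rule: dec_induct)
    case base
    then show ?case by simp
  next
    case (step m)
    have "(t m ^ 2 - c) / \<pi> ^ n \<in> Loc"
      using Loc_div_power_mono[of _ "Suc m" n] inv[of m] step.hyps by auto
    then have "(t m - t n) / \<pi> ^ n - w * ((t m ^ 2 - c) / \<pi> ^ n) \<in> Loc"
      using step.IH w by (intro Loc_diff Loc_mult)
    moreover have "(t m - t n) / \<pi> ^ n - w * ((t m ^ 2 - c) / \<pi> ^ n) = (t (Suc m) - t n) / \<pi> ^ n"
      unfolding t_Suc by (simp add: diff_divide_distrib add_divide_distrib algebra_simps)
    ultimately show ?case by simp
  qed
  have "t \<in> padic_cauchy P"
    unfolding padic_cauchy_iff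
  proof
    fix n
    have "(t l - t m) / \<pi> ^ n \<in> Loc" if "l \<ge> n" "m \<ge> n" for l m
      using Loc_diff[OF step[OF that(1)] step[OF that(2)]] by (simp flip: diff_divide_distrib)
    then show "\<exists>N. \<forall>l\<ge>N. \<forall>m\<ge>N. (t l - t m) / \<pi> ^ n \<in> Loc" by blast
  qed
  moreover have "(\<lambda>n. t n ^ 2 - c) \<in> padic_null P"
    unfolding padic_null_iff
  proof
    fix n
    have "(t m ^ 2 - c) / \<pi> ^ n \<in> Loc" if "m \<ge> n" for m
      using Loc_div_power_mono[of _ "Suc m" n] inv[of m] that by auto
    then show "\<exists>N. \<forall>m\<ge>N. (t m ^ 2 - c) / \<pi> ^ n \<in> Loc" by blast
  qed
  ultimately show ?thesis by (rule square_root_in_completion)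
qed

end

text \<open>If \<open>r\<^sup>2 = a\<close>, then \<open>i - r\<close> is a zero divisor with partner \<open>i + r\<close>; likewise with \<open>j\<close> for \<open>b\<close>. In
  coordinates, a left inverse of \<open>i - r\<close> gives \<open>1 = 0\<close>.\<close>

lemma (in cring) quaternion_algebra_split_if_square:
  assumes ab: "a \<in> carrier R" "b \<in> carrier R" and nontrivial: "\<one> \<noteq> \<zero>"
    and sq: "r \<in> carrier R" "r \<otimes> r = a \<or> r \<otimes> r = b"
  shows "Units (quaternion_algebra R a b) \<noteq> carrier (quaternion_algebra R a b) - {\<zero>\<^bsub>quaternion_algebra R a b\<^esub>}"
    (is "Units ?A \<noteq> _")
proof
  assume div: "Units ?A = carrier ?A - {\<zero>\<^bsub>?A\<^esub>}"
  show False
    using sq(2)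
  proof
    assume sq: "r \<otimes> r = a"
    \<comment> \<open>The zero divisor \<open>i - r\<close>.\<close>
    define z where "z = (\<ominus> r, \<one>, \<zero>, \<zero>)"
    have "z \<in> Units ?A"
      unfolding div using nontrivial \<open>r \<in> carrier R\<close> by (auto simp: z_def quaternion_algebra_def)
    then obtain x where "x \<in> carrier ?A" "x \<otimes>\<^bsub>?A\<^esub> z = \<one>\<^bsub>?A\<^esub>"
      by (auto simp: Units_def)
    then obtain x0 x1 x2 x3 where x: "x0 \<in> carrier R" "x1 \<in> carrier R" "x2 \<in> carrier R" "x3 \<in> carrier R"
      and "x0 \<otimes> (\<ominus> r) \<oplus> a \<otimes> x1 \<otimes> \<one> \<oplus> b \<otimes> x2 \<otimes> \<zero> \<ominus> a \<otimes> b \<otimes> x3 \<otimes> \<zero> = \<one>"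
      and "x0 \<otimes> \<one> \<oplus> x1 \<otimes> (\<ominus> r) \<oplus> b \<otimes> x3 \<otimes> \<zero> \<ominus> b \<otimes> x2 \<otimes> \<zero> = \<zero>"
      by (cases x) (auto simp: z_def quaternion_algebra_def)
    then have 1: "x0 \<otimes> (\<ominus> r) \<oplus> a \<otimes> x1 = \<one>" and 2: "x0 \<oplus> x1 \<otimes> (\<ominus> r) = \<zero>"
      using ab \<open>r \<in> carrier R\<close> by (simp_all add: minus_eq)
    have "\<one> = x0 \<otimes> (\<ominus> r) \<oplus> (r \<otimes> r) \<otimes> x1" using 1 sq by simp
    also have "\<dots> = (\<ominus> r) \<otimes> (x0 \<oplus> x1 \<otimes> (\<ominus> r))" using x \<open>r \<in> carrier R\<close> by algebra
    finally show False using 2 nontrivial \<open>r \<in> carrier R\<close> by simp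
  next
    assume sq: "r \<otimes> r = b"
    \<comment> \<open>The zero divisor \<open>j - r\<close>.\<close>
    define z where "z = (\<ominus> r, \<zero>, \<one>, \<zero>)"
    have "z \<in> Units ?A"
      unfolding div using nontrivial \<open>r \<in> carrier R\<close> by (auto simp: z_def quaternion_algebra_def)
    then obtain x where "x \<in> carrier ?A" "x \<otimes>\<^bsub>?A\<^esub> z = \<one>\<^bsub>?A\<^esub>"
      by (auto simp: Units_def)
    then obtain x0 x1 x2 x3 where x: "x0 \<in> carrier R" "x1 \<in> carrier R" "x2 \<in> carrier R" "x3 \<in> carrier R"
      and "x0 \<otimes> (\<ominus> r) \<oplus> a \<otimes> x1 \<otimes> \<zero> \<oplus> b \<otimes> x2 \<otimes> \<one> \<ominus> a \<otimes> b \<otimes> x3 \<otimes> \<zero> = \<one>"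
      and "x0 \<otimes> \<one> \<oplus> x2 \<otimes> (\<ominus> r) \<oplus> a \<otimes> x1 \<otimes> \<zero> \<ominus> a \<otimes> x3 \<otimes> \<zero> = \<zero>"
      by (cases x) (auto simp: z_def quaternion_algebra_def)
    then have 1: "x0 \<otimes> (\<ominus> r) \<oplus> b \<otimes> x2 = \<one>" and 2: "x0 \<oplus> x2 \<otimes> (\<ominus> r) = \<zero>"
      using ab \<open>r \<in> carrier R\<close> by (simp_all add: minus_eq)
    have "\<one> = x0 \<otimes> (\<ominus> r) \<oplus> (r \<otimes> r) \<otimes> x2" using 1 sq by simp
    also have "\<dots> = (\<ominus> r) \<otimes> (x0 \<oplus> x2 \<otimes> (\<ominus> r))" using x \<open>r \<in> carrier R\<close> by algebra
    finally show False using 2 nontrivial \<open>r \<in> carrier R\<close> by simp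
  qed
qed

context prime_uniformizer
begin

text \<open>If \<open>v\<close> were a local unit, \<open>u / v\<close> would be a square root of \<open>c\<close> modulo \<open>\<pi>\<close>. It would lift to the
  completion, where the algebra would then have zero divisors, against ramification.\<close>

lemma ramified_anisotropic:
  assumes ram: "ramified_at a b P" and c: "c = a \<or> c = b" "algebraic_int c" "c \<notin> P" and two: "2 \<notin> P"
    and uv: "u \<in> Loc" "v \<in> Loc" "(u ^ 2 - c * v ^ 2) / \<pi> \<in> Loc"
  shows "u / \<pi> \<in> Loc" "v / \<pi> \<in> Loc"
proof -
  interpret \<phi>: ring_hom_cring "padic_cauchy_ring P" "completion P"
    "\<lambda>u. padic_null P +>\<^bsub>padic_cauchy_ring P\<^esub> u"
    by (rule coset_hom_completion)
  have closed: "to_completion P x \<in> carrier (completion P)" for x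
    unfolding to_completion_def using \<phi>.hom_closed[of "\<lambda>_. x"] by (simp add: padic_cauchy_const)
  show v: "v / \<pi> \<in> Loc"
  proof (rule ccontr)
    assume "v / \<pi> \<notin> Loc"
    then have iv: "1 / v \<in> Loc" and "v \<noteq> 0" using Loc_unit[OF uv(2)] by auto
    have "u * (1 / v) \<in> Loc" using uv(1) iv by (rule Loc_mult)
    moreover have "((u * (1 / v)) ^ 2 - c) / \<pi> = (1 / v) ^ 2 * ((u ^ 2 - c * v ^ 2) / \<pi>)"
      using \<open>v \<noteq> 0\<close> pi by (simp add: field_simps)
    moreover have "(1 / v) ^ 2 * ((u ^ 2 - c * v ^ 2) / \<pi>) \<in> Loc"
      by (rule Loc_mult[OF Loc_power[OF iv] uv(3)])
    ultimately obtain r where r: "r \<in> carrier (completion P)" "r \<otimes>\<^bsub>completion P\<^esub> r = to_completion P c"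
      using hensel_square_root[OF c(2,3) two, of "u * (1 / v)"] by metis
    then show False
      using \<phi>.S.quaternion_algebra_split_if_square[OF closed closed one_neq_zero_completion r(1), of a b]
        c(1) ram by (auto simp: ramified_at_def Let_def)
  qed
  show "u / \<pi> \<in> Loc"
  proof (rule ccontr)
    assume "u / \<pi> \<notin> Loc"
    then have iu: "1 / u \<in> Loc" and "u \<noteq> 0" using Loc_unit[OF uv(1)] by auto
    have "u ^ 2 / \<pi> = (u ^ 2 - c * v ^ 2) / \<pi> + c * v * (v / \<pi>)"
      by (simp add: power2_eq_square diff_divide_distrib)
    moreover have "(u ^ 2 - c * v ^ 2) / \<pi> + c * v * (v / \<pi>) \<in> Loc"
      using uv v c(2) by (intro Loc_add Loc_mult) auto
    ultimately have "u ^ 2 / \<pi> \<in> Loc" by simp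
    then have "(1 / u) * (u ^ 2 / \<pi>) \<in> Loc" by (rule Loc_mult[OF iu])
    then show False using \<open>u / \<pi> \<notin> Loc\<close> \<open>u \<noteq> 0\<close> by (simp add: power2_eq_square)
  qed
qed

end

section \<open>Integrality of reduced trace and norm on orders\<close>

lemma quat_alg_simps [simp]:
  fixes a b :: "'k::field_char_0"
  shows "carrier (quat_alg a b) = UNIV"
    and "(x0, x1, x2, x3) \<otimes>\<^bsub>quat_alg a b\<^esub> (y0, y1, y2, y3) =
      (x0 * y0 + a * x1 * y1 + b * x2 * y2 - a * b * x3 * y3,
       x0 * y1 + x1 * y0 + b * x3 * y2 - b * x2 * y3,
       x0 * y2 + x2 * y0 + a * x1 * y3 - a * x3 * y1,
       x0 * y3 + x3 * y0 + x1 * y2 - x2 * y1)"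
    and "(x0, x1, x2, x3) \<oplus>\<^bsub>quat_alg a b\<^esub> (y0, y1, y2, y3) = (x0 + y0, x1 + y1, x2 + y2, x3 + y3)"
    and "c \<odot>\<^bsub>quat_alg a b\<^esub> (x0, x1, x2, x3) = (c * x0, c * x1, c * x2, c * x3)"
    and "\<one>\<^bsub>quat_alg a b\<^esub> = (1, 0, 0, 0)" and "\<zero>\<^bsub>quat_alg a b\<^esub> = (0, 0, 0, 0)"
  by (auto simp: quaternion_algebra_def)

lemma abelian_group_quat_alg: "abelian_group (quat_alg a b)"
proof (rule abelian_groupI)
  fix x :: "'a quaternion"
  show "\<exists>y\<in>carrier (quat_alg a b). y \<oplus>\<^bsub>quat_alg a b\<^esub> x = \<zero>\<^bsub>quat_alg a b\<^esub>"
    by (rule bexI[of _ "case x of (x0, x1, x2, x3) \<Rightarrow> (- x0, - x1, - x2, - x3)"]; cases x) simp_all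
qed (auto simp: add_ac)

lemma submodule_quat_alg_iff:
  fixes N :: "'k::field_char_0 quaternion set"
  assumes "- 1 \<in> carrier R"
  shows "submodule N R (quat_alg a b) \<longleftrightarrow>
    (0, 0, 0, 0) \<in> N \<and> (\<forall>x\<in>N. \<forall>y\<in>N. x \<oplus>\<^bsub>quat_alg a b\<^esub> y \<in> N) \<and>
    (\<forall>c\<in>carrier R. \<forall>x\<in>N. c \<odot>\<^bsub>quat_alg a b\<^esub> x \<in> N)"
proof -
  interpret abelian_group "quat_alg a b" by (rule abelian_group_quat_alg)
  have inv: "inv\<^bsub>add_monoid (quat_alg a b)\<^esub> x = (- 1) \<odot>\<^bsub>quat_alg a b\<^esub> x" for x
    unfolding a_inv_def[symmetric] by (cases x, rule minus_equality) auto
  show ?thesis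
  proof (intro iffI conjI ballI)
    assume "submodule N R (quat_alg a b)"
    then interpret submodule N R "quat_alg a b" .
    show "(0, 0, 0, 0) \<in> N" using one_closed by simp
    show "x \<oplus>\<^bsub>quat_alg a b\<^esub> y \<in> N" if "x \<in> N" "y \<in> N" for x y using m_closed[OF that] by simp
    show "c \<odot>\<^bsub>quat_alg a b\<^esub> x \<in> N" if "c \<in> carrier R" "x \<in> N" for c x using that by (rule smult_closed)
  next
    assume N: "(0, 0, 0, 0) \<in> N \<and> (\<forall>x\<in>N. \<forall>y\<in>N. x \<oplus>\<^bsub>quat_alg a b\<^esub> y \<in> N) \<and>
      (\<forall>c\<in>carrier R. \<forall>x\<in>N. c \<odot>\<^bsub>quat_alg a b\<^esub> x \<in> N)"
    show "submodule N R (quat_alg a b)"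
    proof
      show "N \<subseteq> carrier (add_monoid (quat_alg a b))" by simp
      show "x \<otimes>\<^bsub>add_monoid (quat_alg a b)\<^esub> y \<in> N" if "x \<in> N" "y \<in> N" for x y using N that by simp
      show "\<one>\<^bsub>add_monoid (quat_alg a b)\<^esub> \<in> N" using N by simp
      show "inv\<^bsub>add_monoid (quat_alg a b)\<^esub> x \<in> N" if "x \<in> N" for x
        unfolding inv using N assms that by blast
      show "c \<odot>\<^bsub>quat_alg a b\<^esub> x \<in> N" if "c \<in> carrier R" "x \<in> N" for c x using N that by blast
    qed
  qed
qed

lemma submodule_span_mem_iff:
  "x \<in> submodule_span R M E \<longleftrightarrow> (\<forall>N. submodule N R M \<longrightarrow> E \<subseteq> N \<longrightarrow> x \<in> N)"
  by (auto simp: submodule_span_def hull_def)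

lemma minus_one_in_OK: "(- 1 :: 'k::field_char_0) \<in> carrier ring_of_integers"
  by simp

lemmas OK_submodule_iff = submodule_quat_alg_iff[OF minus_one_in_OK]

text \<open>The hull that defines the span is made explicit, so that membership can be checked in coordinates.\<close>

lemma submodule_span_four:
  fixes e1 e2 e3 e4 :: "'k::field_char_0 quaternion"
  shows "submodule_span ring_of_integers (quat_alg a b) {e1, e2, e3, e4} =
    {y1 \<odot>\<^bsub>quat_alg a b\<^esub> e1 \<oplus>\<^bsub>quat_alg a b\<^esub> (y2 \<odot>\<^bsub>quat_alg a b\<^esub> e2 \<oplus>\<^bsub>quat_alg a b\<^esub>
      (y3 \<odot>\<^bsub>quat_alg a b\<^esub> e3 \<oplus>\<^bsub>quat_alg a b\<^esub> y4 \<odot>\<^bsub>quat_alg a b\<^esub> e4)) | y1 y2 y3 y4.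
      algebraic_int y1 \<and> algebraic_int y2 \<and> algebraic_int y3 \<and> algebraic_int y4}"
    (is "_ = ?L")
proof -
  obtain e10 e11 e12 e13 e20 e21 e22 e23 e30 e31 e32 e33 e40 e41 e42 e43 where
    e: "e1 = (e10, e11, e12, e13)" "e2 = (e20, e21, e22, e23)" "e3 = (e30, e31, e32, e33)"
      "e4 = (e40, e41, e42, e43)"
    by (metis prod.exhaust)
  define f where "f = (\<lambda>y1 y2 y3 y4. y1 \<odot>\<^bsub>quat_alg a b\<^esub> e1 \<oplus>\<^bsub>quat_alg a b\<^esub> (y2 \<odot>\<^bsub>quat_alg a b\<^esub> e2 \<oplus>\<^bsub>quat_alg a b\<^esub>
      (y3 \<odot>\<^bsub>quat_alg a b\<^esub> e3 \<oplus>\<^bsub>quat_alg a b\<^esub> y4 \<odot>\<^bsub>quat_alg a b\<^esub> e4)))"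
  have f_add: "f y1 y2 y3 y4 \<oplus>\<^bsub>quat_alg a b\<^esub> f z1 z2 z3 z4 = f (y1 + z1) (y2 + z2) (y3 + z3) (y4 + z4)"
    for y1 y2 y3 y4 z1 z2 z3 z4
    by (simp add: f_def e algebra_simps)
  have f_smult: "c \<odot>\<^bsub>quat_alg a b\<^esub> f y1 y2 y3 y4 = f (c * y1) (c * y2) (c * y3) (c * y4)"
    for c y1 y2 y3 y4
    by (simp add: f_def e algebra_simps)
  have L: "?L = {f y1 y2 y3 y4 | y1 y2 y3 y4.
      algebraic_int y1 \<and> algebraic_int y2 \<and> algebraic_int y3 \<and> algebraic_int y4}" (is "_ = ?L'")
    by (simp add: f_def)
  have memI: "f y1 y2 y3 y4 \<in> ?L'"
    if "algebraic_int y1" "algebraic_int y2" "algebraic_int y3" "algebraic_int y4" for y1 y2 y3 y4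
    using that by blast
  show ?thesis
    unfolding L
  proof (intro subset_antisym subsetI)
    fix x assume x: "x \<in> submodule_span ring_of_integers (quat_alg a b) {e1, e2, e3, e4}"
    have "submodule ?L' ring_of_integers (quat_alg a b)"
      unfolding OK_submodule_iff
    proof (intro conjI ballI)
      show "(0, 0, 0, 0) \<in> ?L'" using memI[of 0 0 0 0] by (simp add: f_def e)
    next
      fix x y assume "x \<in> ?L'" "y \<in> ?L'"
      then obtain y1 y2 y3 y4 z1 z2 z3 z4 where
        "x = f y1 y2 y3 y4" "algebraic_int y1" "algebraic_int y2" "algebraic_int y3" "algebraic_int y4"
        "y = f z1 z2 z3 z4" "algebraic_int z1" "algebraic_int z2" "algebraic_int z3" "algebraic_int z4"
        by blast
      then show "x \<oplus>\<^bsub>quat_alg a b\<^esub> y \<in> ?L'"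
        using memI[of "y1 + z1" "y2 + z2" "y3 + z3" "y4 + z4"] by (simp only: f_add algebraic_int_add)
    next
      fix c :: 'k and x assume "c \<in> carrier ring_of_integers" "x \<in> ?L'"
      then obtain y1 y2 y3 y4 where "algebraic_int c"
        "x = f y1 y2 y3 y4" "algebraic_int y1" "algebraic_int y2" "algebraic_int y3" "algebraic_int y4"
        by auto
      then show "c \<odot>\<^bsub>quat_alg a b\<^esub> x \<in> ?L'"
        using memI[of "c * y1" "c * y2" "c * y3" "c * y4"] by (simp only: f_smult algebraic_int_mult)
    qed
    moreover have "{e1, e2, e3, e4} \<subseteq> ?L'"
      using memI[of 1 0 0 0] memI[of 0 1 0 0] memI[of 0 0 1 0] memI[of 0 0 0 1] by (simp add: f_def e)
    ultimately show "x \<in> ?L'" using x unfolding submodule_span_mem_iff by blast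
  next
    fix x assume "x \<in> ?L'"
    then obtain y1 y2 y3 y4 where x: "x = f y1 y2 y3 y4"
      and y: "algebraic_int y1" "algebraic_int y2" "algebraic_int y3" "algebraic_int y4" by blast
    show "x \<in> submodule_span ring_of_integers (quat_alg a b) {e1, e2, e3, e4}"
      unfolding submodule_span_mem_iff OK_submodule_iff x f_def using y by simp
  qed
qed

definition trd :: "'k::field_char_0 quaternion \<Rightarrow> 'k" where
  "trd = (\<lambda>(x0, x1, x2, x3). 2 * x0)"

definition nrd :: "'k::field_char_0 \<Rightarrow> 'k \<Rightarrow> 'k quaternion \<Rightarrow> 'k" where
  "nrd a b = (\<lambda>(x0, x1, x2, x3). x0 ^ 2 - a * x1 ^ 2 - b * x2 ^ 2 + a * b * x3 ^ 2)"

text \<open>The symmetric bilinear form with \<open>norm_form a b x x = nrd a b x\<close>.\<close>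

definition norm_form :: "'k::field_char_0 \<Rightarrow> 'k \<Rightarrow> 'k quaternion \<Rightarrow> 'k quaternion \<Rightarrow> 'k" where
  "norm_form a b = (\<lambda>(x0, x1, x2, x3) (y0, y1, y2, y3). x0 * y0 - a * x1 * y1 - b * x2 * y2 + a * b * x3 * y3)"

text \<open>Let \<open>N(e, f)\<close> be the real part of \<open>e\<^sup>* f\<close>, where \<open>e\<^sup>*\<close> is the conjugate. Then
  \<open>(x e)\<^sup>* f + e\<^sup>* (x f) = e\<^sup>* (x\<^sup>* + x) f\<close>, and \<open>x\<^sup>* + x\<close> is the scalar \<open>trd x\<close>.\<close>

lemma trd_norm_form:
  "trd x * norm_form a b e f = norm_form a b (x \<otimes>\<^bsub>quat_alg a b\<^esub> e) f + norm_form a b e (x \<otimes>\<^bsub>quat_alg a b\<^esub> f)"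
  by (cases x, cases e, cases f) (simp add: trd_def norm_form_def algebra_simps)

text \<open>Here \<open>(x e)\<^sup>* (x f) = e\<^sup>* (x\<^sup>* x) f\<close> with the scalar \<open>x\<^sup>* x = nrd x\<close>.\<close>

lemma nrd_norm_form:
  "nrd a b x * norm_form a b e f = norm_form a b (x \<otimes>\<^bsub>quat_alg a b\<^esub> e) (x \<otimes>\<^bsub>quat_alg a b\<^esub> f)"
  by (cases x, cases e, cases f) (simp add: nrd_def norm_form_def algebra_simps power2_eq_square)

text \<open>Let \<open>E\<close> generate \<open>L\<close>. The \<open>R\<close>-module generated by the values of the norm form on \<open>E\<close> contains its
  values on \<open>L\<close>. By the two identities above it is preserved by multiplication with \<open>trd x\<close> and
  \<open>nrd x\<close>, so the determinant trick applies in the base field itself. The module is nonzero because \<open>N(1, 1) = 1\<close>.\<close>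

lemma order_trd_nrd_integral:
  fixes L :: "'k::field_char_0 quaternion set"
  assumes L: "order_in a b L" and x: "x \<in> L"
  shows "algebraic_int (trd x)" "algebraic_int (nrd a b x)"
proof -
  interpret subring L "quat_alg a b" using L by (simp add: order_in_def)
  obtain E where E: "finite E" "L = submodule_span ring_of_integers (quat_alg a b) E"
    using L by (auto simp: order_in_def complete_lattice_in_def)
  \<comment> \<open>Bilinearity carries membership from the generators to \<open>L\<close>, one argument at a time.\<close>
  define V where "V = {norm_form a b e f | e f. e \<in> E \<and> f \<in> E}"
  have EL: "E \<subseteq> L" unfolding E(2) submodule_span_def by (rule hull_subset)
  have half: "norm_form a b e y \<in> int_span V" if "e \<in> E" "y \<in> L" for e y
  proof -
    have "submodule {y. norm_form a b e y \<in> int_span V} ring_of_integers (quat_alg a b)"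
      unfolding OK_submodule_iff
    proof (intro conjI ballI)
      show "(0, 0, 0, 0) \<in> {y. norm_form a b e y \<in> int_span V}"
        by (cases e) (auto simp: norm_form_def intro: int_span.zero)
    next
      fix y z assume "y \<in> {y. norm_form a b e y \<in> int_span V}" "z \<in> {y. norm_form a b e y \<in> int_span V}"
      moreover have "norm_form a b e (y \<oplus>\<^bsub>quat_alg a b\<^esub> z) = norm_form a b e y + norm_form a b e z"
        by (cases e, cases y, cases z) (simp add: norm_form_def algebra_simps)
      ultimately show "y \<oplus>\<^bsub>quat_alg a b\<^esub> z \<in> {y. norm_form a b e y \<in> int_span V}"
        by (auto intro: int_span.add)
    next
      fix c :: 'k and y assume "c \<in> carrier ring_of_integers" "y \<in> {y. norm_form a b e y \<in> int_span V}"
      moreover have "norm_form a b e (c \<odot>\<^bsub>quat_alg a b\<^esub> y) = c * norm_form a b e y"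
        by (cases e, cases y) (simp add: norm_form_def algebra_simps)
      ultimately show "c \<odot>\<^bsub>quat_alg a b\<^esub> y \<in> {y. norm_form a b e y \<in> int_span V}"
        by (auto intro: int_span.scale)
    qed
    moreover have "E \<subseteq> {y. norm_form a b e y \<in> int_span V}"
      using \<open>e \<in> E\<close> unfolding V_def by (blast intro: int_span.base)
    ultimately show ?thesis using \<open>y \<in> L\<close> unfolding E(2) submodule_span_mem_iff by blast
  qed
  have sym: "norm_form a b y z = norm_form a b z y" for y z
    by (cases y, cases z) (simp add: norm_form_def mult_ac)
  have full: "norm_form a b z y \<in> int_span V" if "z \<in> L" "y \<in> L" for z y
  proof -
    have "submodule {z. norm_form a b y z \<in> int_span V} ring_of_integers (quat_alg a b)"
      unfolding OK_submodule_iff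
    proof (intro conjI ballI)
      show "(0, 0, 0, 0) \<in> {z. norm_form a b y z \<in> int_span V}"
        by (cases y) (auto simp: norm_form_def intro: int_span.zero)
    next
      fix u z assume "u \<in> {z. norm_form a b y z \<in> int_span V}" "z \<in> {z. norm_form a b y z \<in> int_span V}"
      moreover have "norm_form a b y (u \<oplus>\<^bsub>quat_alg a b\<^esub> z) = norm_form a b y u + norm_form a b y z"
        by (cases u, cases y, cases z) (simp add: norm_form_def algebra_simps)
      ultimately show "u \<oplus>\<^bsub>quat_alg a b\<^esub> z \<in> {z. norm_form a b y z \<in> int_span V}"
        by (auto intro: int_span.add)
    next
      fix c :: 'k and z assume "c \<in> carrier ring_of_integers" "z \<in> {z. norm_form a b y z \<in> int_span V}"
      moreover have "norm_form a b y (c \<odot>\<^bsub>quat_alg a b\<^esub> z) = c * norm_form a b y z"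
        by (cases y, cases z) (simp add: norm_form_def algebra_simps)
      ultimately show "c \<odot>\<^bsub>quat_alg a b\<^esub> z \<in> {z. norm_form a b y z \<in> int_span V}"
        by (auto intro: int_span.scale)
    qed
    moreover have "E \<subseteq> {z. norm_form a b y z \<in> int_span V}"
      using half[OF _ \<open>y \<in> L\<close>] sym by auto
    ultimately have "norm_form a b y z \<in> int_span V"
      using \<open>z \<in> L\<close> unfolding E(2) submodule_span_mem_iff by blast
    then show ?thesis using sym by simp
  qed
  have "\<exists>v\<in>V. v \<noteq> 0"
  proof (rule ccontr)
    assume *: "\<not> ?thesis"
    have "v = 0" if "v \<in> int_span V" for v
      using that by induction (use * in auto)
    moreover have "norm_form a b (1, 0, 0, 0) (1, 0, 0, 0) \<in> int_span V"
      using full[OF one_closed one_closed] by simp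
    ultimately have "norm_form a b (1, 0, 0, 0) (1, 0, 0, 0) = 0" by blast
    then show False by (simp add: norm_form_def)
  qed
  then obtain v where v: "v \<in> V" "v \<noteq> 0" by blast
  have "V \<subseteq> (\<lambda>z. norm_form a b (fst z) (snd z)) ` (E \<times> E)" unfolding V_def by force
  then have fin: "finite V" by (rule finite_subset) (use E(1) in simp)
  show "algebraic_int (trd x)"
  proof (rule algebraic_int_if_int_span_stable[OF fin v])
    fix w assume "w \<in> V"
    then obtain e f where w: "w = norm_form a b e f" "e \<in> L" "f \<in> L" using EL unfolding V_def by blast
    show "trd x * w \<in> int_span V"
      unfolding w(1) trd_norm_form[of x a b] using w x by (intro int_span.add full m_closed)
  qed
  show "algebraic_int (nrd a b x)"
  proof (rule algebraic_int_if_int_span_stable[OF fin v])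
    fix w assume "w \<in> V"
    then obtain e f where w: "w = norm_form a b e f" "e \<in> L" "f \<in> L" using EL unfolding V_def by blast
    show "nrd a b x * w \<in> int_span V"
      unfolding w(1) nrd_norm_form[of a b x] using w x by (intro full m_closed)
  qed
qed

section \<open>The order generated by i and \<open>\<beta>\<close>\<close>

text \<open>The set of all \<open>y0 + y1 i + y2 \<beta> + y3 i \<beta>\<close> with integral coefficients, for \<open>\<beta> = (p + q i + j) / 2\<close>.\<close>

definition enlarged_order :: "'k::field_char_0 \<Rightarrow> 'k \<Rightarrow> 'k \<Rightarrow> 'k quaternion set" where
  "enlarged_order a p q =
    {(y0 + p * y2 / 2 + a * q * y3 / 2, y1 + q * y2 / 2 + p * y3 / 2, y2 / 2, y3 / 2) | y0 y1 y2 y3.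
      algebraic_int y0 \<and> algebraic_int y1 \<and> algebraic_int y2 \<and> algebraic_int y3}"

lemma enlarged_orderI:
  assumes "algebraic_int y0" "algebraic_int y1" "algebraic_int y2" "algebraic_int y3"
    "x0 = y0 + p * y2 / 2 + a * q * y3 / 2" "x1 = y1 + q * y2 / 2 + p * y3 / 2" "x2 = y2 / 2" "x3 = y3 / 2"
  shows "(x0, x1, x2, x3) \<in> enlarged_order a p q"
  using assms unfolding enlarged_order_def by blast

lemma enlarged_order_eq_span:
  "enlarged_order a p q = submodule_span ring_of_integers (quat_alg a b)
     {\<one>\<^bsub>quat_alg a b\<^esub>, qi, (p / 2, q / 2, 1 / 2, 0), qi \<otimes>\<^bsub>quat_alg a b\<^esub> (p / 2, q / 2, 1 / 2, 0)}"
  unfolding submodule_span_four enlarged_order_def by (simp add: qi_def mult_ac add_ac)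

lemma standard_order_eq:
  "standard_order a b = {(y0, y1, y2, y3). algebraic_int y0 \<and> algebraic_int y1 \<and> algebraic_int y2 \<and> algebraic_int y3}"
  unfolding standard_order_def submodule_span_four by (auto simp: qi_def qj_def)

lemma standard_order_subset_enlarged:
  assumes "algebraic_int a" "algebraic_int p" "algebraic_int q"
  shows "standard_order a b \<subseteq> enlarged_order a p q"
proof
  fix x assume "x \<in> standard_order a b"
  then obtain x0 x1 x2 x3 where x: "x = (x0, x1, x2, x3)"
    "algebraic_int x0" "algebraic_int x1" "algebraic_int x2" "algebraic_int x3"
    by (auto simp: standard_order_eq)
  show "x \<in> enlarged_order a p q"
    unfolding x(1) using x assms
    by (intro enlarged_orderI[of "x0 - p * x2 - a * q * x3" "x1 - q * x2 - p * x3" "2 * x2" "2 * x3"])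
      (auto simp: algebra_simps)
qed

text \<open>With \<open>t\<^sup>*\<close> the conjugate in \<open>R[i]\<close> and \<open>w = a q + p i\<close>, the products are governed by
  \<open>\<beta> t = t\<^sup>* \<beta> + t\<^sub>1 w\<close> for \<open>t = t\<^sub>0 + t\<^sub>1 i\<close> and by \<open>\<beta>\<^sup>2 = p \<beta> - c\<close>. The four coefficients in the
  proof come from expanding \<open>(Y + Y' \<beta>) (Z + Z' \<beta>)\<close> by these rules.\<close>

lemma enlarged_order_mult_closed:
  assumes int: "algebraic_int a" "algebraic_int p" "algebraic_int q" "algebraic_int c"
    and c: "p ^ 2 - a * q ^ 2 - b = 4 * c"
    and x: "x \<in> enlarged_order a p q" and x': "x' \<in> enlarged_order a p q"
  shows "x \<otimes>\<^bsub>quat_alg a b\<^esub> x' \<in> enlarged_order a p q"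
proof -
  obtain y0 y1 y2 y3 where y: "algebraic_int y0" "algebraic_int y1" "algebraic_int y2" "algebraic_int y3"
    "x = (y0 + p * y2 / 2 + a * q * y3 / 2, y1 + q * y2 / 2 + p * y3 / 2, y2 / 2, y3 / 2)"
    using x unfolding enlarged_order_def by blast
  obtain z0 z1 z2 z3 where z: "algebraic_int z0" "algebraic_int z1" "algebraic_int z2" "algebraic_int z3"
    "x' = (z0 + p * z2 / 2 + a * q * z3 / 2, z1 + q * z2 / 2 + p * z3 / 2, z2 / 2, z3 / 2)"
    using x' unfolding enlarged_order_def by blast
  have b: "b = p ^ 2 - a * q ^ 2 - 4 * c" using c by (simp add: algebra_simps)
  show ?thesis
    unfolding y(5) z(5) quat_alg_simps b
    by (rule enlarged_orderI[of
      "y0 * z0 + a * y1 * z1 + z1 * (q * a * y2 + a * p * y3) - c * (y2 * z2 - a * y3 * z3)"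
      "y0 * z1 + y1 * z0 + z1 * (p * y2 + q * a * y3) - c * (y3 * z2 - y2 * z3)"
      "y0 * z2 + a * y1 * z3 + y2 * z0 - a * y3 * z1 + p * (y2 * z2 - a * y3 * z3) + z3 * (q * a * y2 + a * p * y3)"
      "y0 * z3 + y1 * z2 + y3 * z0 - y2 * z1 + p * (y3 * z2 - y2 * z3) + z3 * (p * y2 + q * a * y3)"])
      (use int y z in \<open>simp_all add: field_simps power2_eq_square\<close>)
qed

lemma submodule_enlarged_order:
  fixes a :: "'k::field_char_0"
  shows "submodule (enlarged_order a p q) ring_of_integers (quat_alg a b)"
    (is "submodule ?L _ ?A")
  unfolding OK_submodule_iff
proof (intro conjI ballI)
  show "(0, 0, 0, 0) \<in> ?L" by (rule enlarged_orderI[of 0 0 0 0]) auto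
next
  fix x x' assume "x \<in> ?L" "x' \<in> ?L"
  then obtain y0 y1 y2 y3 z0 z1 z2 z3 where y: "algebraic_int y0" "algebraic_int y1" "algebraic_int y2" "algebraic_int y3"
    "x = (y0 + p * y2 / 2 + a * q * y3 / 2, y1 + q * y2 / 2 + p * y3 / 2, y2 / 2, y3 / 2)"
    and z: "algebraic_int z0" "algebraic_int z1" "algebraic_int z2" "algebraic_int z3"
    "x' = (z0 + p * z2 / 2 + a * q * z3 / 2, z1 + q * z2 / 2 + p * z3 / 2, z2 / 2, z3 / 2)"
    unfolding enlarged_order_def by blast
  show "x \<oplus>\<^bsub>?A\<^esub> x' \<in> ?L"
    unfolding y(5) z(5) quat_alg_simps using y z
    by (intro enlarged_orderI[of "y0 + z0" "y1 + z1" "y2 + z2" "y3 + z3"]) (simp_all add: field_simps)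
next
  fix r x assume "r \<in> carrier (ring_of_integers :: 'k ring)" "x \<in> ?L"
  then obtain y0 y1 y2 y3 where y: "algebraic_int y0" "algebraic_int y1" "algebraic_int y2" "algebraic_int y3"
    "x = (y0 + p * y2 / 2 + a * q * y3 / 2, y1 + q * y2 / 2 + p * y3 / 2, y2 / 2, y3 / 2)"
    and r: "algebraic_int r"
    unfolding enlarged_order_def by auto
  show "r \<odot>\<^bsub>?A\<^esub> x \<in> ?L"
    unfolding y(5) quat_alg_simps using y r
    by (intro enlarged_orderI[of "r * y0" "r * y1" "r * y2" "r * y3"]) (simp_all add: field_simps)
qed

lemma order_enlarged_order:
  fixes a :: "'k::field_char_0"
  assumes int: "algebraic_int a" "algebraic_int p" "algebraic_int q" "algebraic_int c"
    and c: "p ^ 2 - a * q ^ 2 - b = 4 * c"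
  shows "order_in a b (enlarged_order a p q)"
proof -
  let ?L = "enlarged_order a p q" and ?A = "quat_alg a b"
  have "subgroup ?L (add_monoid ?A)" using submodule_enlarged_order[of a p q b] by (simp add: submodule_def)
  moreover have "submonoid ?L ?A"
  proof
    show "\<one>\<^bsub>?A\<^esub> \<in> ?L" unfolding quat_alg_simps by (rule enlarged_orderI[of 1 0 0 0]) auto
  qed (use enlarged_order_mult_closed[OF int c] in auto)
  ultimately have "subring ?L ?A" by (simp add: subring_def)
  moreover have "\<exists>E. finite E \<and> ?L = submodule_span ring_of_integers ?A E"
    by (rule exI[of _ "{\<one>\<^bsub>?A\<^esub>, qi, (p / 2, q / 2, 1 / 2, 0), qi \<otimes>\<^bsub>?A\<^esub> (p / 2, q / 2, 1 / 2, 0)}"], rule conjI)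
      (simp, rule enlarged_order_eq_span)
  moreover have "submodule_span field_ring ?A ?L = carrier ?A"
  proof -
    have basis: "(1, 0, 0, 0) \<in> ?L" "(0, 1, 0, 0) \<in> ?L" "(0, 0, 1, 0) \<in> ?L" "(0, 0, 0, 1) \<in> ?L"
      using standard_order_subset_enlarged[OF int(1-3), of b] by (auto simp: standard_order_eq)
    have "(x0, x1, x2, x3) \<in> N"
      if N: "submodule N field_ring ?A" "?L \<subseteq> N" for N x0 x1 x2 x3
    proof -
      have N': "\<And>x y. x \<in> N \<Longrightarrow> y \<in> N \<Longrightarrow> x \<oplus>\<^bsub>?A\<^esub> y \<in> N" "\<And>c x. x \<in> N \<Longrightarrow> c \<odot>\<^bsub>?A\<^esub> x \<in> N"
        using N(1) by (auto simp: submodule_quat_alg_iff)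
      have "x0 \<odot>\<^bsub>?A\<^esub> (1, 0, 0, 0) \<oplus>\<^bsub>?A\<^esub> (x1 \<odot>\<^bsub>?A\<^esub> (0, 1, 0, 0) \<oplus>\<^bsub>?A\<^esub> (x2 \<odot>\<^bsub>?A\<^esub> (0, 0, 1, 0) \<oplus>\<^bsub>?A\<^esub>
        x3 \<odot>\<^bsub>?A\<^esub> (0, 0, 0, 1))) \<in> N"
        using basis N(2) by (intro N') auto
      then show ?thesis by simp
    qed
    then show ?thesis by (auto simp: submodule_span_mem_iff)
  qed
  ultimately show ?thesis by (simp add: order_in_def complete_lattice_in_def)
qed

text \<open>The order spanned by \<open>1, i, \<beta>, i \<beta>\<close> has reduced discriminant \<open>a b\<close>, so every element that pairs
  integrally with it under the trace lies in its multiple by \<open>1 / (a b)\<close>. The proof inverts the Gram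
  matrix: the coefficients of \<open>a b x\<close> are written as \<open>R\<close>-combinations of the traces of
  \<open>x, x i, x j, x i j, x \<beta>, x i \<beta>\<close>.\<close>

lemma integral_multiple_in_enlarged_order:
  assumes int: "algebraic_int a" "algebraic_int b" "algebraic_int p" "algebraic_int q" "algebraic_int c"
    and c: "p ^ 2 - a * q ^ 2 - b = 4 * c"
    and L: "order_in a b L" "enlarged_order a p q \<subseteq> L" and x: "x \<in> L"
  shows "(a * b) \<odot>\<^bsub>quat_alg a b\<^esub> x \<in> enlarged_order a p q"
proof -
  interpret subring L "quat_alg a b" using L by (simp add: order_in_def)
  obtain x0 x1 x2 x3 where x_eq: "x = (x0, x1, x2, x3)" by (metis prod.exhaust)
  have trace: "algebraic_int (trd (x \<otimes>\<^bsub>quat_alg a b\<^esub> e))" if "e \<in> enlarged_order a p q" for e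
    by (rule order_trd_nrd_integral(1)[OF L(1) m_closed[OF x subsetD[OF L(2) that]]])
  have std: "(y0, y1, y2, y3) \<in> enlarged_order a p q"
    if "algebraic_int y0" "algebraic_int y1" "algebraic_int y2" "algebraic_int y3" for y0 y1 y2 y3
    using standard_order_subset_enlarged[OF int(1,3,4), of b] that by (auto simp: standard_order_eq)
  have "(p / 2, q / 2, 1 / 2, 0) \<in> enlarged_order a p q" "(a * q / 2, p / 2, 0, 1 / 2) \<in> enlarged_order a p q"
    by (rule enlarged_orderI[of 0 0 1 0]; simp) (rule enlarged_orderI[of 0 0 0 1]; simp)
  note this[THEN trace]
  then have T: "algebraic_int (p * x0 + q * a * x1 + b * x2)" "algebraic_int (a * q * x0 + a * p * x1 - a * b * x3)"
    by (simp_all add: x_eq trd_def algebra_simps)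
  have A0: "algebraic_int (2 * x0)" using trace[OF std[of 1 0 0 0]] by (simp add: x_eq trd_def)
  have A1: "algebraic_int (2 * a * x1)" using trace[OF std[of 0 1 0 0]] by (simp add: x_eq trd_def mult_ac)
  have A2: "algebraic_int (2 * b * x2)" using trace[OF std[of 0 0 1 0]] by (simp add: x_eq trd_def mult_ac)
  have "algebraic_int (- (2 * a * b * x3))" using trace[OF std[of 0 0 0 1]] by (simp add: x_eq trd_def mult_ac)
  then have A3: "algebraic_int (2 * a * b * x3)" unfolding algebraic_int_minus_iff .
  have b: "b = p ^ 2 - a * q ^ 2 - 4 * c" using c by (simp add: algebra_simps)
  show ?thesis
    unfolding x_eq quat_alg_simps
  proof (rule enlarged_orderI)
    show "algebraic_int (a * (b + 2 * c) * (2 * x0) - (a * p * (p * x0 + q * a * x1 + b * x2)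
        - a * q * (a * q * x0 + a * p * x1 - a * b * x3)))"
      using int A0 T by (simp only: algebraic_int_diff algebraic_int_mult algebraic_int_add algebraic_int_numeral)
    show "algebraic_int (p * (a * q * x0 + a * p * x1 - a * b * x3) - a * q * (p * x0 + q * a * x1 + b * x2)
        - 2 * c * (2 * a * x1))"
      using int A1 T by (simp only: algebraic_int_diff algebraic_int_mult algebraic_int_add algebraic_int_numeral)
    show "algebraic_int (a * (2 * b * x2))" using int A2 by simp
    show "algebraic_int (2 * a * b * x3)" by (rule A3)
    show "a * b * x0 = a * (b + 2 * c) * (2 * x0) - (a * p * (p * x0 + q * a * x1 + b * x2)
        - a * q * (a * q * x0 + a * p * x1 - a * b * x3)) + p * (a * (2 * b * x2)) / 2
        + a * q * (2 * a * b * x3) / 2"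
      unfolding b by (simp add: field_simps power2_eq_square)
    show "a * b * x1 = p * (a * q * x0 + a * p * x1 - a * b * x3) - a * q * (p * x0 + q * a * x1 + b * x2)
        - 2 * c * (2 * a * x1) + q * (a * (2 * b * x2)) / 2 + p * (2 * a * b * x3) / 2"
      unfolding b by (simp add: field_simps power2_eq_square)
  qed simp_all
qed

section \<open>Maximality\<close>

lemma OK_idealI:
  assumes "\<And>x. x \<in> J \<Longrightarrow> algebraic_int x" "0 \<in> J" "\<And>x y. x \<in> J \<Longrightarrow> y \<in> J \<Longrightarrow> x + y \<in> J"
    "\<And>r x. algebraic_int r \<Longrightarrow> x \<in> J \<Longrightarrow> r * x \<in> J"
  shows "ideal (J :: 'k::field_char_0 set) ring_of_integers"
proof (rule idealI)
  show "ring (ring_of_integers :: 'k ring)" by (rule OK.ring_axioms)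
  have inv: "\<ominus>\<^bsub>ring_of_integers\<^esub> x = - x" if "algebraic_int x" for x :: 'k
    using that by (intro OK.minus_equality) auto
  show "subgroup J (add_monoid ring_of_integers)"
  proof (rule OK.add.subgroupI)
    fix x assume "x \<in> J"
    then show "\<ominus>\<^bsub>ring_of_integers\<^esub> x \<in> J"
      using assms(1)[of x] assms(4)[of "-1" x] by (simp add: inv)
  qed (use assms in auto)
  fix x r :: 'k assume "x \<in> J" "r \<in> carrier ring_of_integers"
  then show "r \<otimes>\<^bsub>ring_of_integers\<^esub> x \<in> J" "x \<otimes>\<^bsub>ring_of_integers\<^esub> r \<in> J"
    using assms(4)[of r x] by (simp_all add: mult.commute)
qed

lemma PIdl_OK: "x \<in> PIdl\<^bsub>ring_of_integers\<^esub> c \<longleftrightarrow> (\<exists>r. algebraic_int r \<and> x = r * c)"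
  by (auto simp: cgenideal_def)

text \<open>Write \<open>d R = P Q\<close> with \<open>Q\<close> the product of the other primes. As nonzero primes are maximal, \<open>Q\<close> is
  not inside \<open>P\<close>; any \<open>s\<close> in \<open>Q\<close> outside \<open>P\<close> satisfies \<open>s P \<subseteq> d R\<close>. Thus a generator of a product of
  distinct primes is a uniformizer at each of them.\<close>

lemma prime_factor_uniformizer:
  fixes d :: "'k::field_char_0"
  assumes nf: "number_field TYPE('k)" and fin: "finite S"
    and S: "\<And>Q. Q \<in> S \<Longrightarrow> primeideal Q ring_of_integers \<and> Q \<noteq> {0}"
    and prod: "ideal_product S = PIdl\<^bsub>ring_of_integers\<^esub> d" and d: "d \<noteq> 0"
    and P: "P \<in> S"
  shows "prime_uniformizer P d"
proof (rule prime_uniformizer.intro)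
  define T where "T = S - {P}"
  have ST: "S = insert P T" "P \<notin> T" "finite T" using P fin by (auto simp: T_def)
  have T: "primeideal Q ring_of_integers \<and> Q \<noteq> {0}" if "Q \<in> insert P T" for Q
    using S that ST by simp
  have split: "ideal_product S = ideal_prod ring_of_integers P (ideal_product T)"
    unfolding ST(1) using T by (intro ideal_product_insert[OF ST(3,2)]) auto
  show "number_field TYPE('k)" by (rule nf)
  show prime: "primeideal P ring_of_integers" using S P by blast
  have idT: "ideal (ideal_product T) ring_of_integers" by (rule ideal_ideal_product) (use T in auto)
  have "d \<in> ideal_product S" unfolding prod PIdl_OK by (intro exI[of _ 1]) auto
  then show "d \<in> P"
    unfolding split using OK.ideal_prod_inter[OF primeideal_OK(1)[OF prime] idT] by blast
  show "d \<noteq> 0" by (rule d)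
  have "\<exists>s\<in>ideal_product T. s \<notin> P"
  proof (rule ideal_product_avoids_prime[OF ST(3) _ prime])
    fix Q assume "Q \<in> T"
    then show "primeideal Q ring_of_integers" using T by blast
    show "\<not> Q \<subseteq> P"
      using primeideal_subset_eq[of Q P] T[of Q] prime \<open>Q \<in> T\<close> ST(2) by blast
  qed
  then obtain s where s: "s \<in> ideal_product T" "s \<notin> P" by blast
  have "\<exists>r. algebraic_int r \<and> s * x = d * r" if "x \<in> P" for x
  proof -
    have "x * s \<in> PIdl\<^bsub>ring_of_integers\<^esub> d"
      unfolding prod[symmetric] split by (rule ideal_prod_OK[OF that s(1)])
    then show ?thesis unfolding PIdl_OK by (metis mult.commute)
  qed
  then show "\<exists>s. algebraic_int s \<and> s \<notin> P \<and> (\<forall>x\<in>P. \<exists>r. algebraic_int r \<and> s * x = d * r)"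
    using s ideal_OK(1)[OF idT s(1)] by blast
qed

text \<open>If 2 and \<open>c\<close> are in \<open>P\<close>, then so is \<open>c'\<close>, and \<open>c = c'\<^sup>2 - 4 r\<close> is divisible by \<open>\<pi>\<^sup>2\<close> locally.\<close>

lemma (in prime_uniformizer) two_notin_if_square_mod_4:
  assumes pi_eq: "c * d = \<pi>" and c: "c \<in> P" and d: "algebraic_int d"
    and sq: "algebraic_int c'" "algebraic_int r" "c' ^ 2 - c = 4 * r"
  shows "2 \<notin> P"
proof
  assume two: "2 \<in> P"
  have "c' ^ 2 = c + (2 * r) * 2" using sq(3) by (simp add: algebra_simps)
  moreover have "c + (2 * r) * 2 \<in> P" using two c sq by (intro P_ideal(3) P_ideal(4)) auto
  ultimately have "c' ^ 2 \<in> P" by simp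
  then have c'P: "c' \<in> P" by (rule primeideal_OK_power[OF prime sq(1)])
  have "d * ((c' / \<pi>) * (c' / \<pi>) - (2 / \<pi>) * (2 / \<pi>) * r) \<in> Loc"
    using in_P_iff[OF sq(1)] in_P_iff[of 2] c'P two d sq by (intro Loc_mult Loc_diff) auto
  also have "d * ((c' / \<pi>) * (c' / \<pi>) - (2 / \<pi>) * (2 / \<pi>) * r) = d * (c' ^ 2 - 4 * r) / (\<pi> * \<pi>)"
    by (simp add: power2_eq_square diff_divide_distrib right_diff_distrib)
  also have "c' ^ 2 - 4 * r = c" using sq(3) by (simp add: algebra_simps)
  also have "d * c / (\<pi> * \<pi>) = 1 / \<pi>" using pi by (simp flip: pi_eq)
  finally show False using inverse_pi_notin_Loc by simp
qed

text \<open>Say \<open>a\<close> is the one of \<open>a, b\<close> in \<open>P\<close>. The traces give denominators at most \<open>a\<close>, and only in \<open>x1\<close> and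
  \<open>x3\<close>. Integrality of the norm makes \<open>(a x1)\<^sup>2 - b (a x3)\<^sup>2\<close> divisible by \<open>a\<close>, and since this form is
  anisotropic modulo \<open>P\<close>, both \<open>a x1\<close> and \<open>a x3\<close> are divisible by \<open>a\<close>.\<close>

lemma (in prime_uniformizer) coordinates_in_Loc:
  assumes pi_eq: "a * b = \<pi>" and int: "algebraic_int a" "algebraic_int b"
    and ram: "ramified_at a b P" and two: "2 \<notin> P" and cop: "\<not> (a \<in> P \<and> b \<in> P)"
    and x: "2 * x0 \<in> Loc" "2 * a * x1 \<in> Loc" "2 * b * x2 \<in> Loc" "2 * a * b * x3 \<in> Loc"
      "x0 ^ 2 - a * x1 ^ 2 - b * x2 ^ 2 + a * b * x3 ^ 2 \<in> Loc"
  shows "x0 \<in> Loc" "x1 \<in> Loc" "x2 \<in> Loc" "x3 \<in> Loc"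
proof -
  have ab: "a \<noteq> 0" "b \<noteq> 0" using pi_eq pi by auto
  have half: "1 / 2 \<in> Loc" using Loc_inverse[of 2] two by simp
  have halve: "y \<in> Loc" if "2 * y \<in> Loc" for y using Loc_mult[OF half that] by simp
  have x0: "x0 \<in> Loc" and A1: "a * x1 \<in> Loc" and A2: "b * x2 \<in> Loc" and A3: "a * b * x3 \<in> Loc"
    using x by (auto intro!: halve simp: mult.assoc)
  show "x0 \<in> Loc" by (rule x0)
  define n where "n = x0 ^ 2 - a * x1 ^ 2 - b * x2 ^ 2 + a * b * x3 ^ 2"
  have n: "n \<in> Loc" using x(5) by (simp add: n_def)
  have "a \<in> P \<or> b \<in> P" using P_prime[OF int] pi(1) pi_eq by simp
  then consider "a \<in> P" "b \<notin> P" | "b \<in> P" "a \<notin> P" using cop by blast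
  then have "x1 \<in> Loc \<and> x2 \<in> Loc \<and> x3 \<in> Loc"
  proof cases
    case 1
    have ib: "1 / b \<in> Loc" by (rule Loc_inverse[OF int(2) 1(2)])
    have x2: "x2 \<in> Loc" using Loc_mult[OF ib A2] ab by simp
    have v: "a * x3 \<in> Loc" using Loc_mult[OF ib A3] ab by simp
    \<comment> \<open>The norm, divided by \<open>b\<close> and solved for the two terms with possible denominators.\<close>
    have "1 / b * (x0 ^ 2 - b * x2 ^ 2 - n) \<in> Loc" using ib x0 x2 n int by (intro Loc_mult Loc_diff Loc_power) auto
    also have "1 / b * (x0 ^ 2 - b * x2 ^ 2 - n) = ((a * x1) ^ 2 - b * (a * x3) ^ 2) / \<pi>"
      unfolding pi_eq[symmetric] n_def using ab by (simp add: field_simps power2_eq_square)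
    finally have "a * x1 / \<pi> \<in> Loc" "a * x3 / \<pi> \<in> Loc"
      using ramified_anisotropic[OF ram _ int(2) 1(2) two A1 v] by auto
    then have "b * (a * x1 / \<pi>) \<in> Loc" "b * (a * x3 / \<pi>) \<in> Loc" using int by (auto simp del: times_divide_eq_right)
    then show ?thesis using x2 ab by (simp add: pi_eq[symmetric])
  next
    case 2
    have ia: "1 / a \<in> Loc" by (rule Loc_inverse[OF int(1) 2(2)])
    have x1: "x1 \<in> Loc" using Loc_mult[OF ia A1] ab by simp
    have v: "b * x3 \<in> Loc" using Loc_mult[OF ia A3] ab by (simp add: mult.assoc)
    have "1 / a * (x0 ^ 2 - a * x1 ^ 2 - n) \<in> Loc" using ia x0 x1 n int by (intro Loc_mult Loc_diff Loc_power) auto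
    also have "1 / a * (x0 ^ 2 - a * x1 ^ 2 - n) = ((b * x2) ^ 2 - a * (b * x3) ^ 2) / \<pi>"
      unfolding pi_eq[symmetric] n_def using ab by (simp add: field_simps power2_eq_square)
    finally have "b * x2 / \<pi> \<in> Loc" "b * x3 / \<pi> \<in> Loc"
      using ramified_anisotropic[OF ram _ int(1) 2(2) two A2 v] by auto
    then have "a * (b * x2 / \<pi>) \<in> Loc" "a * (b * x3 / \<pi>) \<in> Loc" using int by (auto simp del: times_divide_eq_right)
    then show ?thesis using x1 ab by (simp add: pi_eq[symmetric])
  qed
  then show "x1 \<in> Loc" "x2 \<in> Loc" "x3 \<in> Loc" by blast+
qed

text \<open>For \<open>x\<close> in a larger order, the multipliers \<open>r\<close> with \<open>r x\<close> in the given order form an ideal \<open>J\<close>. It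
  contains \<open>a b\<close>, and it is not contained in any ramified prime. As \<open>a b R\<close> is the product of
  these primes, \<open>J\<close> is the unit ideal.\<close>

lemma maximal_enlarged_order:
  fixes a b :: "'k::field_char_0"
  assumes nf: "number_field TYPE('k)" and ab: "a * b \<noteq> 0"
    and int: "algebraic_int a" "algebraic_int b" "algebraic_int p" "algebraic_int q" "algebraic_int c"
    and c: "p ^ 2 - a * q ^ 2 - b = 4 * c"
    and fin: "finite (ramified_primes a b)"
    and disc: "ideal_product (ramified_primes a b) = PIdl\<^bsub>ring_of_integers\<^esub> (a * b)"
    and two: "\<And>P. P \<in> ramified_primes a b \<Longrightarrow> 2 \<notin> P"
    and cop: "\<And>P. P \<in> ramified_primes a b \<Longrightarrow> \<not> (a \<in> P \<and> b \<in> P)"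
  shows "maximal_order_in a b (enlarged_order a p q)"
proof -
  let ?L = "enlarged_order a p q" and ?A = "quat_alg a b"
  have ord: "order_in a b ?L" by (rule order_enlarged_order[OF int(1,3,4,5) c])
  interpret L: subring ?L ?A using ord by (simp add: order_in_def)
  have Lsub: "submodule ?L ring_of_integers ?A" by (rule submodule_enlarged_order)
  have std: "(y0, y1, y2, y3) \<in> ?L"
    if "algebraic_int y0" "algebraic_int y1" "algebraic_int y2" "algebraic_int y3" for y0 y1 y2 y3
    using standard_order_subset_enlarged[OF int(1,3,4), of b] that by (auto simp: standard_order_eq)
  have S: "primeideal Q ring_of_integers \<and> Q \<noteq> {0}" if "Q \<in> ramified_primes a b" for Q
    using that by (simp add: ramified_primes_def)
  have "x \<in> ?L" if L': "order_in a b L'" "?L \<subseteq> L'" and x: "x \<in> L'" for L' x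
  proof -
    interpret L': subring L' ?A using L' by (simp add: order_in_def)
    obtain x0 x1 x2 x3 where x_eq: "x = (x0, x1, x2, x3)" by (metis prod.exhaust)
    have trace: "algebraic_int (trd (x \<otimes>\<^bsub>?A\<^esub> e))" if "e \<in> ?L" for e
      by (rule order_trd_nrd_integral(1)[OF L'(1) L'.m_closed[OF x subsetD[OF L'(2) that]]])
    have A0: "algebraic_int (2 * x0)" using trace[OF std[of 1 0 0 0]] by (simp add: x_eq trd_def)
    have A1: "algebraic_int (2 * a * x1)" using trace[OF std[of 0 1 0 0]] by (simp add: x_eq trd_def mult_ac)
    have A2: "algebraic_int (2 * b * x2)" using trace[OF std[of 0 0 1 0]] by (simp add: x_eq trd_def mult_ac)
    have "algebraic_int (- (2 * a * b * x3))" using trace[OF std[of 0 0 0 1]] by (simp add: x_eq trd_def mult_ac)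
    then have A3: "algebraic_int (2 * a * b * x3)" unfolding algebraic_int_minus_iff .
    have N: "algebraic_int (x0 ^ 2 - a * x1 ^ 2 - b * x2 ^ 2 + a * b * x3 ^ 2)"
      using order_trd_nrd_integral(2)[OF L'(1) x] by (simp add: x_eq nrd_def)
    define J where "J = {r. algebraic_int r \<and> r \<odot>\<^bsub>?A\<^esub> x \<in> ?L}"
    have L_add: "y \<oplus>\<^bsub>?A\<^esub> z \<in> ?L" if "y \<in> ?L" "z \<in> ?L" for y z
      using Lsub that unfolding OK_submodule_iff by blast
    have L_smult: "r \<odot>\<^bsub>?A\<^esub> y \<in> ?L" if "algebraic_int r" "y \<in> ?L" for r y
      using Lsub that unfolding OK_submodule_iff by simp
    have J: "ideal J ring_of_integers"
    proof (rule OK_idealI)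
      show "0 \<in> J" using std[of 0 0 0 0] by (simp add: J_def x_eq)
      show "r + s \<in> J" if "r \<in> J" "s \<in> J" for r s
        using that L_add[of "r \<odot>\<^bsub>?A\<^esub> x" "s \<odot>\<^bsub>?A\<^esub> x"] by (simp add: J_def x_eq distrib_right)
      show "r * s \<in> J" if "algebraic_int r" "s \<in> J" for r s
        using that L_smult[of r "s \<odot>\<^bsub>?A\<^esub> x"] by (simp add: J_def x_eq mult.assoc)
    qed (simp add: J_def)
    have "\<not> J \<subseteq> P" if P: "P \<in> ramified_primes a b" for P
    proof -
      interpret prime_uniformizer P "a * b"
        by (rule prime_factor_uniformizer[OF nf fin S disc ab P])
      have ram: "ramified_at a b P" using P by (simp add: ramified_primes_def)
      have "{x0, x1, x2, x3} \<subseteq> Loc"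
        using coordinates_in_Loc[OF refl int(1,2) ram two[OF P] cop[OF P], of x0 x1 x2 x3] A0 A1 A2 A3 N
        by auto
      then obtain s where s: "algebraic_int s" "s \<notin> P" "\<forall>y\<in>{x0, x1, x2, x3}. algebraic_int (s * y)"
        using Loc_common_denominator[of "{x0, x1, x2, x3}"] by auto
      then have "s \<in> J" using std by (simp add: J_def x_eq)
      then show ?thesis using s(2) by blast
    qed
    from unit_ideal_from_local[OF fin S J this]
    obtain z where z: "z \<in> ideal_product (ramified_primes a b)" "1 - z \<in> J" by blast
    obtain r where r: "algebraic_int r" "z = r * (a * b)" using z(1) unfolding disc PIdl_OK by blast
    have "a * b \<in> J"
      using integral_multiple_in_enlarged_order[OF int c L' x] int by (simp add: J_def)
    then have "z \<in> J" using r ideal_OK(4)[OF J] by simp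
    have "1 \<in> J" using ideal_OK(3)[OF J z(2) \<open>z \<in> J\<close>] by simp
    then show ?thesis by (simp add: J_def x_eq)
  qed
  then show ?thesis using ord by (auto simp: maximal_order_in_def)
qed

text \<open>The ideal generated by \<open>a'\<close> and 2 contains \<open>a\<close>, and no prime factor of \<open>a\<close> contains it.\<close>

lemma odd_inverse_mod_2:
  fixes a :: "'k::field_char_0"
  assumes fin: "finite S" and S: "\<And>Q. Q \<in> S \<Longrightarrow> primeideal Q ring_of_integers \<and> Q \<noteq> {0}"
    and prod: "ideal_product S = PIdl\<^bsub>ring_of_integers\<^esub> a"
    and two: "\<And>P. P \<in> S \<Longrightarrow> 2 \<notin> P"
    and a': "algebraic_int a'" "algebraic_int r" "a' ^ 2 - a = 4 * r"
  shows "\<exists>u v. algebraic_int u \<and> algebraic_int v \<and> a' * u + 2 * v = 1"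
proof -
  define J where "J = {a' * u + 2 * v | u v. algebraic_int u \<and> algebraic_int v}"
  have memI: "a' * u + 2 * v \<in> J" if "algebraic_int u" "algebraic_int v" for u v
    using that unfolding J_def by blast
  have J: "ideal J ring_of_integers"
  proof (rule OK_idealI)
    show "algebraic_int x" if "x \<in> J" for x using that a' unfolding J_def by auto
    show "0 \<in> J" using memI[of 0 0] by simp
    show "x + y \<in> J" if xy: "x \<in> J" "y \<in> J" for x y
    proof -
      obtain u v u' v' where "x = a' * u + 2 * v" "y = a' * u' + 2 * v'"
        "algebraic_int u" "algebraic_int v" "algebraic_int u'" "algebraic_int v'"
        using xy unfolding J_def by blast
      then show ?thesis using memI[of "u + u'" "v + v'"] by (simp add: algebra_simps)
    qed
    show "s * x \<in> J" if sx: "algebraic_int s" "x \<in> J" for s x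
    proof -
      obtain u v where "x = a' * u + 2 * v" "algebraic_int u" "algebraic_int v"
        using sx(2) unfolding J_def by blast
      then show ?thesis using memI[of "s * u" "s * v"] sx(1) by (simp add: algebra_simps)
    qed
  qed
  have "2 \<in> J" using memI[of 0 1] by simp
  then obtain z where z: "z \<in> PIdl\<^bsub>ring_of_integers\<^esub> a" "1 - z \<in> J"
    using unit_ideal_from_local[OF fin S J] two unfolding prod by blast
  obtain s where s: "algebraic_int s" "z = s * a" using z(1) unfolding PIdl_OK by blast
  have "a = a' * a' + 2 * (- 2 * r)" using a'(3) by (simp add: power2_eq_square algebra_simps)
  then have "a \<in> J" using memI[of a' "- 2 * r"] a' by (metis algebraic_int_minus algebraic_int_mult algebraic_int_numeral)
  then have "z \<in> J" using s ideal_OK(4)[OF J] by simp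
  have "1 \<in> J" using ideal_OK(3)[OF J z(2) \<open>z \<in> J\<close>] by simp
  then show ?thesis unfolding J_def by auto
qed

theorem proposition5p4:
  fixes a b :: "'k::field_char_0"
  assumes "number_field TYPE('k)"
    and "a \<noteq> 0" and "b \<noteq> 0"
    and "a \<in> carrier ring_of_integers" and "b \<in> carrier ring_of_integers"
    and "Idl\<^bsub>ring_of_integers\<^esub> {a, b} = carrier ring_of_integers"
    and "(\<exists>a' \<in> carrier ring_of_integers. \<exists>b' \<in> carrier ring_of_integers.
            a'^2 - a \<in> PIdl\<^bsub>ring_of_integers\<^esub> 4 \<and> b'^2 - b \<in> PIdl\<^bsub>ring_of_integers\<^esub> 4) \<or>
         (b = -1 \<and> (\<exists>a' \<in> carrier ring_of_integers. a'^2 - a \<in> PIdl\<^bsub>ring_of_integers\<^esub> 4))"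
    and "discriminant a b = PIdl\<^bsub>ring_of_integers\<^esub> (a * b)"
  shows "\<exists>\<beta> \<in> (\<lambda>x. (1 / 2) \<odot>\<^bsub>quat_alg a b\<^esub> x) ` standard_order a b.
           let L = submodule_span ring_of_integers (quat_alg a b)
                     {\<one>\<^bsub>quat_alg a b\<^esub>, qi, \<beta>, qi \<otimes>\<^bsub>quat_alg a b\<^esub> \<beta>}
           in maximal_order_in a b L \<and> standard_order a b \<subseteq> L"
proof -
  let ?S = "ramified_primes a b"
  have ab: "a * b \<noteq> 0" using assms(2,3) by simp
  have int: "algebraic_int a" "algebraic_int b" using assms(4,5) by auto
  have S: "primeideal Q ring_of_integers \<and> Q \<noteq> {0}" if "Q \<in> ?S" for Q
    using that by (simp add: ramified_primes_def)
  \<comment> \<open>The default value of the discriminant is excluded because \<open>a b\<close> is nonzero.\<close>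
  have fin: "finite ?S"
  proof (rule ccontr)
    assume "infinite ?S"
    then have "PIdl\<^bsub>ring_of_integers\<^esub> (a * b) = {0}" using assms(8) by (simp add: discriminant_def)
    moreover have "a * b \<in> PIdl\<^bsub>ring_of_integers\<^esub> (a * b)" unfolding PIdl_OK by (intro exI[of _ 1]) auto
    ultimately show False using ab by simp
  qed
  then have disc: "ideal_product ?S = PIdl\<^bsub>ring_of_integers\<^esub> (a * b)"
    using assms(8) by (simp add: discriminant_def)
  have cop: "\<not> (a \<in> P \<and> b \<in> P)" if "P \<in> ?S" for P
  proof
    assume "a \<in> P \<and> b \<in> P"
    have P: "primeideal P ring_of_integers" using S that by blast
    have "Idl\<^bsub>ring_of_integers\<^esub> {a, b} \<subseteq> P"
      by (rule OK.genideal_minimal[OF primeideal_OK(1)[OF P]]) (use \<open>a \<in> P \<and> b \<in> P\<close> in auto)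
    then show False using assms(6) primeideal_OK(2)[OF P] by auto
  qed
  obtain a' r where a': "algebraic_int a'" "algebraic_int r" "a' ^ 2 - a = 4 * r"
    using assms(7) unfolding PIdl_OK by (auto simp: mult.commute)
  have b': "b = -1 \<or> (\<exists>b' s. algebraic_int b' \<and> algebraic_int s \<and> b' ^ 2 - b = 4 * s)"
    using assms(7) unfolding PIdl_OK by (auto simp: mult.commute)
  have two: "2 \<notin> P" if P: "P \<in> ?S" for P
  proof -
    interpret prime_uniformizer P "a * b"
      by (rule prime_factor_uniformizer[OF assms(1) fin S disc ab P])
    have "a \<in> P \<or> b \<in> P" using P_prime[OF int pi(1)] .
    then show ?thesis
    proof
      assume "a \<in> P"
      then show ?thesis using two_notin_if_square_mod_4[OF refl _ int(2) a'] by blast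
    next
      assume "b \<in> P"
      have "b \<noteq> -1"
      proof
        assume "b = -1"
        then have "(-1) * b \<in> P" using P_ideal(4)[of "-1" b] \<open>b \<in> P\<close> by simp
        then show False using one_notin_P \<open>b = -1\<close> by simp
      qed
      then obtain b' s where "algebraic_int b'" "algebraic_int s" "b' ^ 2 - b = 4 * s" using b' by blast
      then show ?thesis
        using two_notin_if_square_mod_4[of b a b' s] \<open>b \<in> P\<close> int(1) by (simp add: mult.commute)
    qed
  qed
  \<comment> \<open>The choice of \<open>\<beta>\<close>, through its trace \<open>p\<close>, its \<open>i\<close>-coordinate \<open>q / 2\<close> and its norm \<open>c\<close>.\<close>
  have "\<exists>p q c. algebraic_int p \<and> algebraic_int q \<and> algebraic_int c \<and> p ^ 2 - a * q ^ 2 - b = 4 * c"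
    using b'
  proof
    assume "\<exists>b' s. algebraic_int b' \<and> algebraic_int s \<and> b' ^ 2 - b = 4 * s"
    then obtain b' s where "algebraic_int b'" "algebraic_int s" "b' ^ 2 - b = 4 * s" by blast
    then show ?thesis by (intro exI[of _ b'] exI[of _ s] exI[of _ "0 :: 'k"]) simp
  next
    assume b: "b = -1"
    have "PIdl\<^bsub>ring_of_integers\<^esub> (a * b) = PIdl\<^bsub>ring_of_integers\<^esub> a"
    proof (intro subset_antisym subsetI)
      fix x assume "x \<in> PIdl\<^bsub>ring_of_integers\<^esub> (a * b)"
      then obtain s where "algebraic_int s" "x = s * (a * b)" unfolding PIdl_OK by blast
      then show "x \<in> PIdl\<^bsub>ring_of_integers\<^esub> a" unfolding PIdl_OK by (intro exI[of _ "- s"]) (simp add: b)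
    next
      fix x assume "x \<in> PIdl\<^bsub>ring_of_integers\<^esub> a"
      then obtain s where "algebraic_int s" "x = s * a" unfolding PIdl_OK by blast
      then show "x \<in> PIdl\<^bsub>ring_of_integers\<^esub> (a * b)" unfolding PIdl_OK by (intro exI[of _ "- s"]) (simp add: b)
    qed
    then obtain u v where uv: "algebraic_int u" "algebraic_int v" "a' * u + 2 * v = 1"
      using odd_inverse_mod_2[OF fin S _ two a'] disc by auto
    \<comment> \<open>The square of an element congruent to 1 modulo 2 is 1 modulo 4.\<close>
    have "(a' * u) ^ 2 = (1 - 2 * v) ^ 2" using uv(3) by (metis add_diff_cancel_right')
    then have "a'\<^sup>2 * u ^ 2 = 1 - 4 * v + 4 * v ^ 2" by (simp add: power2_eq_square algebra_simps)
    moreover have "a'\<^sup>2 = a + 4 * r" using a'(3) by (simp add: algebra_simps)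
    ultimately have "0 ^ 2 - a * u ^ 2 - b = 4 * (v - v ^ 2 + r * u ^ 2)"
      by (simp add: b algebra_simps)
    moreover have "algebraic_int (v - v ^ 2 + r * u ^ 2)" using uv a' by simp
    ultimately show ?thesis using uv(1) algebraic_int_0 by blast
  qed
  then obtain p q c where pqc: "algebraic_int p" "algebraic_int q" "algebraic_int c"
    "p ^ 2 - a * q ^ 2 - b = 4 * c" by blast
  show ?thesis
  proof (rule bexI[of _ "(p / 2, q / 2, 1 / 2, 0)"])
    show "(p / 2, q / 2, 1 / 2, 0) \<in> (\<lambda>x. (1 / 2) \<odot>\<^bsub>quat_alg a b\<^esub> x) ` standard_order a b"
      using pqc by (intro image_eqI[of _ _ "(p, q, 1, 0)"]) (auto simp: standard_order_eq)
    show "let L = submodule_span ring_of_integers (quat_alg a b)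
        {\<one>\<^bsub>quat_alg a b\<^esub>, qi, (p / 2, q / 2, 1 / 2, 0), qi \<otimes>\<^bsub>quat_alg a b\<^esub> (p / 2, q / 2, 1 / 2, 0)}
      in maximal_order_in a b L \<and> standard_order a b \<subseteq> L"
      unfolding Let_def enlarged_order_eq_span[symmetric]
      using maximal_enlarged_order[OF assms(1) ab int pqc fin disc two cop]
        standard_order_subset_enlarged[OF int(1) pqc(1,2)] by simp
  qed
qed

end
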